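(* Let $A$ be an $N\times D$ real matrix and $\mathbf b\in\mathbb R^N$. Suppose $P=\{\mathbf x\in\mathbb R^D : A\mathbf x\le\mathbf b\}$ is non-empty and $\mathbf b(t)$ is a continuous function on some interval containing $0$ with $\mathbf b(0)=\mathbf b$. Suppose that for each $t\ne 0$ in the interval, $P(t)=\{\mathbf x: A\mathbf x\le\mathbf b(t)\}$ is a non-empty polyhedron with exactly $\ell$ vertices $w_{t,1},\dots,w_{t,\ell}$, and for each $j$ with $1\le j\le\ell$ there is a fixed cone $K_j$ with $\mathrm{fcone}(P(t),w_{t,j})=K_j$ for all $t\ne 0$. Then: (i) for each fixed $j$, $w_{t,j}$ converges to some vertex of $P$ as $t\to 0$; (ii) for each vertex $v$ of $P$, letting $J_v$ be the set of $j$ for which $w_{t,j}\to v$, we have \[ [\mathrm{fcone}(P,v)]\equiv\sum_{j\in J_v}[K_j] \text{ modulo polyhedra with lines},\] and therefore $f(\mathrm{fcone}(P,v),\mathbf z)=\sum_{j\in J_v}f(K_j,\mathbf z)$.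
   Context: The feasible cone is $\mathrm{fcone}(P,v)=\{u : v+\delta u\in P \text{ for all sufficiently small }\delta>0\}$. $[S]$ denotes the indicator function of a set $S$. Two finite linear combinations of indicator functions of polyhedra are congruent modulo polyhedra with lines if their difference is a finite linear combination of indicator functions of polyhedra that contain a line. For a rational polyhedron $Q\subseteq\mathbb R^D$, $f(Q,\mathbf z)$ is its multivariate generating function: the unique rational function in $\mathbf z=(z_1,\dots,z_D)$ such that $Q\mapsto f(Q,\mathbf z)$ is a valuation, $f(Q,\mathbf z)=\sum_{\alpha\in Q\cap\mathbb Z^D}\mathbf z^\alpha$ (with $\mathbf z^\alpha=\prod z_i^{\alpha_i}$) wherever this series converges absolutely when $Q$ is pointed, and $f(Q,\mathbf z)=0$ when $Q$ contains a line. *)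

theory Defs
  imports
    "HOL-Analysis.Analysis"
    "HOL-Library.Poly_Mapping"
    "HOL-Computational_Algebra.Fraction_Field"
begin

section \<open>Polyhedra and indicator functions\<close>

definition fcone :: "'a::real_vector set \<Rightarrow> 'a \<Rightarrow> 'a set" where
  "fcone P v = {u. \<forall>\<^sub>F \<delta> in at_right (0::real). v + \<delta> *\<^sub>R u \<in> P}"

definition contains_line :: "'a::real_vector set \<Rightarrow> bool" where
  "contains_line Q \<longleftrightarrow> (\<exists>x u. u \<noteq> 0 \<and> (\<forall>s::real. x + s *\<^sub>R u \<in> Q))"

definition indicator_combination :: "'a set set \<Rightarrow> ('a \<Rightarrow> real) \<Rightarrow> bool" where
  "indicator_combination \<Q> g \<longleftrightarrow>
    (\<exists>I c. finite I \<and> I \<subseteq> \<Q> \<and> g = (\<lambda>x. \<Sum>Q\<in>I. c Q * indicator Q x))"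

definition cong_mod_lines :: "('a::euclidean_space \<Rightarrow> real) \<Rightarrow> ('a \<Rightarrow> real) \<Rightarrow> bool" where
  "cong_mod_lines g h \<longleftrightarrow>
    indicator_combination {Q. polyhedron Q} g \<and>
    indicator_combination {Q. polyhedron Q} h \<and>
    indicator_combination {Q. polyhedron Q \<and> contains_line Q} (\<lambda>x. g x - h x)"

definition rational_polyhedron :: "(real ^ 'n) set \<Rightarrow> bool" where
  "rational_polyhedron Q \<longleftrightarrow>
    (\<exists>H. finite H \<and> (\<forall>(a, \<beta>)\<in>H. (\<forall>i. a $ i \<in> \<rat>) \<and> \<beta> \<in> \<rat>) \<and>
         Q = {x. \<forall>(a, \<beta>)\<in>H. a \<bullet> x \<le> \<beta>})"

section \<open>Rational functions in the variables indexed by a finite type\<close>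

text \<open>A polynomial maps exponent vectors to coefficients. The order on the index type
  is used only because the library derives the integral domain structure of the
  polynomial ring, and hence its field of fractions, from it.\<close>

type_synonym 'n polynomial = "('n \<Rightarrow>\<^sub>0 nat) \<Rightarrow>\<^sub>0 complex"
type_synonym 'n ratfun = "'n polynomial fract"

definition ratfun_const :: "complex \<Rightarrow> ('n::{finite,linorder}) ratfun" where
  "ratfun_const c = Fract (Poly_Mapping.single 0 c) 1"

definition poly_eval :: "'n polynomial \<Rightarrow> complex ^ 'n \<Rightarrow> complex" where
  "poly_eval p z = (\<Sum>m\<in>Poly_Mapping.keys p. Poly_Mapping.lookup p m *
    (\<Prod>i\<in>UNIV. z $ i ^ Poly_Mapping.lookup m i))"

text \<open>\<open>ratfun_value r z c\<close>: \<open>r\<close> is regular at \<open>z\<close> with value \<open>c\<close>.\<close>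

definition ratfun_value :: "'n ratfun \<Rightarrow> complex ^ ('n::{finite,linorder}) \<Rightarrow> complex \<Rightarrow> bool" where
  "ratfun_value r z c \<longleftrightarrow>
    (\<exists>p q. r = Fract p q \<and> poly_eval q z \<noteq> 0 \<and> c = poly_eval p z / poly_eval q z)"

section \<open>Multivariate generating functions\<close>

definition lattice_points :: "(real ^ 'n) set \<Rightarrow> (int ^ 'n) set" where
  "lattice_points Q = {\<alpha>. (\<chi> i. real_of_int (\<alpha> $ i)) \<in> Q}"

definition laurent_monomial :: "complex ^ 'n \<Rightarrow> int ^ 'n \<Rightarrow> complex" where
  "laurent_monomial z \<alpha> = (\<Prod>i\<in>UNIV. z $ i powi (\<alpha> $ i))"

definition valuation_on_rational_polyhedra ::
    "((real ^ ('n::{finite,linorder})) set \<Rightarrow> 'n ratfun) \<Rightarrow> bool" where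
  "valuation_on_rational_polyhedra f \<longleftrightarrow>
    (\<forall>I c. finite I \<longrightarrow> (\<forall>Q\<in>I. rational_polyhedron Q) \<longrightarrow>
      (\<forall>x. (\<Sum>Q\<in>I. c Q * indicator Q x) = (0::real)) \<longrightarrow>
      (\<Sum>Q\<in>I. ratfun_const (complex_of_real (c Q)) * f Q) = 0)"

text \<open>The defining properties of the map \<open>Q \<mapsto> f(Q, z)\<close>. By the theorem of Lawrence and
  Khovanskii--Pukhlikov such a map exists, and its values on rational polyhedra are uniquely
  determined; its values on other sets are left unspecified. Points with a zero coordinate
  are excluded because negative exponents occur (and \<open>0 powi k = 0\<close> for \<open>k < 0\<close>).\<close>

definition is_generating_function ::
    "((real ^ ('n::{finite,linorder})) set \<Rightarrow> 'n ratfun) \<Rightarrow> bool" where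
  "is_generating_function f \<longleftrightarrow>
    valuation_on_rational_polyhedra f \<and>
    (\<forall>Q. rational_polyhedron Q \<and> contains_line Q \<longrightarrow> f Q = 0) \<and>
    (\<forall>Q z. rational_polyhedron Q \<and> \<not> contains_line Q \<and> (\<forall>i. z $ i \<noteq> 0) \<and>
       (\<lambda>\<alpha>. norm (laurent_monomial z \<alpha>)) summable_on lattice_points Q \<longrightarrow>
       ratfun_value (f Q) z (\<Sum>\<^sub>\<infinity>\<alpha>\<in>lattice_points Q. laurent_monomial z \<alpha>))"

end

theory Submission
  imports Defs
begin

text \<open>
  For a vector \<open>g\<close> and a convex cone \<open>C\<close> one has, pointwise,
  \<open>[C] + [C + \<real> g] = [C + \<real>\<^sub>+ g] + [C - \<real>\<^sub>+ g]\<close>, so modulo lines \<open>C\<close> is the sum of the two cones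
  obtained by adjoining \<open>g\<close> or \<open>-g\<close>. Cutting a finite family of cones along all of their generators
  shows that \<open>\<Sum> c\<^sub>i [C\<^sub>i]\<close> vanishes modulo lines as soon as, for generic \<open>\<xi>\<close>, the \<open>c\<^sub>i\<close> of those \<open>C\<^sub>i\<close> on
  which \<open>\<xi>\<close> is positive add up to \<open>0\<close>. All cones involved stay rational if the \<open>C\<^sub>i\<close> are, although the
  matrix need not be; this gives the identity of generating functions.

  If \<open>w t j\<close> tends to \<open>v\<close>, then \<open>P - v\<close> is contained in \<open>K j\<close>, because inequalities that are not active
  at \<open>v\<close> are not active at \<open>w t j\<close> for small \<open>t\<close>. As \<open>K j\<close> is pointed, \<open>v\<close> is a vertex and the only
  cluster point. Moreover, if a generic \<open>\<xi>\<close> is positive on the feasible cone at \<open>v\<close>, then the vertex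
  \<open>w t j\<close> minimising \<open>\<xi>\<close> over \<open>Pt t\<close> yields the one and only \<open>j\<close> in \<open>J\<close> with \<open>\<xi>\<close> positive on
  \<open>K j\<close>; and \<open>\<xi>\<close> positive on some \<open>K j\<close> with \<open>j\<close> in \<open>J\<close> is positive on the smaller feasible cone at \<open>v\<close>.
\<close>

section \<open>Finite combinations of indicator functions\<close>

lemma indicator_combination_zero: "indicator_combination \<Q> (\<lambda>x. 0)"
  unfolding indicator_combination_def by (intro exI[of _ "{}"]) auto

lemma indicator_combination_mono:
  assumes "indicator_combination \<Q> g" "\<Q> \<subseteq> \<R>"
  shows "indicator_combination \<R> g"
proof -
  obtain I c where "finite I" "I \<subseteq> \<Q>" "g = (\<lambda>x. \<Sum>Q\<in>I. c Q * indicator Q x)"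
    using assms(1) unfolding indicator_combination_def by blast
  then show ?thesis
    using assms(2) unfolding indicator_combination_def by (intro exI[of _ I] exI[of _ c]) blast
qed

lemma indicator_combination_indicator:
  assumes "Q \<in> \<Q>"
  shows "indicator_combination \<Q> (indicator Q)"
  unfolding indicator_combination_def using assms
  by (intro exI[of _ "{Q}"] exI[of _ "\<lambda>_. 1"]) auto

lemma indicator_combination_cmult:
  assumes "indicator_combination \<Q> g"
  shows "indicator_combination \<Q> (\<lambda>x. k * g x)"
proof -
  obtain I c where I: "finite I" "I \<subseteq> \<Q>" "g = (\<lambda>x. \<Sum>Q\<in>I. c Q * indicator Q x)"
    using assms unfolding indicator_combination_def by blast
  moreover have "k * g x = (\<Sum>Q\<in>I. (k * c Q) * indicator Q x)" for x
    unfolding I(3) by (simp only: sum_distrib_left mult.assoc)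
  ultimately show ?thesis
    unfolding indicator_combination_def
    by (intro exI[of _ I] exI[of _ "\<lambda>Q. k * c Q"]) (simp only: simp_thms)
qed

lemma indicator_combination_add:
  assumes "indicator_combination \<Q> g" "indicator_combination \<Q> h"
  shows "indicator_combination \<Q> (\<lambda>x. g x + h x)"
proof -
  obtain I c where I: "finite I" "I \<subseteq> \<Q>" "g = (\<lambda>x. \<Sum>Q\<in>I. c Q * indicator Q x)"
    using assms(1) unfolding indicator_combination_def by blast
  obtain J d where J: "finite J" "J \<subseteq> \<Q>" "h = (\<lambda>x. \<Sum>Q\<in>J. d Q * indicator Q x)"
    using assms(2) unfolding indicator_combination_def by blast
  define e where "e Q = (if Q \<in> I then c Q else 0) + (if Q \<in> J then d Q else 0)" for Q
  have "g x + h x = (\<Sum>Q\<in>I \<union> J. e Q * indicator Q x)" for x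
  proof -
    have "g x = (\<Sum>Q\<in>I \<union> J. (if Q \<in> I then c Q else 0) * indicator Q x)"
      unfolding I(3) using I(1) J(1) by (intro sum.mono_neutral_cong_left) auto
    moreover have "h x = (\<Sum>Q\<in>I \<union> J. (if Q \<in> J then d Q else 0) * indicator Q x)"
      unfolding J(3) using I(1) J(1) by (intro sum.mono_neutral_cong_left) auto
    ultimately show ?thesis
      unfolding e_def by (simp only: distrib_right sum.distrib)
  qed
  then show ?thesis
    unfolding indicator_combination_def using I J
    by (intro exI[of _ "I \<union> J"] exI[of _ e]) auto
qed

lemma indicator_combination_sum:
  assumes "\<And>i. i \<in> N \<Longrightarrow> indicator_combination \<Q> (g i)"
  shows "indicator_combination \<Q> (\<lambda>x. \<Sum>i\<in>N. g i x)"
  using assms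
proof (induction N rule: infinite_finite_induct)
  case (insert i N)
  then show ?case
    by (simp add: indicator_combination_add)
qed (auto simp: indicator_combination_zero)

section \<open>Polyhedral cones with coefficients in a ring\<close>

text \<open>Used with \<open>F = UNIV\<close> for the congruence and with \<open>F = \<rat>\<close>
  for generating functions; elimination forms new coefficients by ring operations only.\<close>

definition subring :: "real set \<Rightarrow> bool" where
  "subring F \<longleftrightarrow> 0 \<in> F \<and> 1 \<in> F \<and> (\<forall>x\<in>F. - x \<in> F) \<and>
    (\<forall>x\<in>F. \<forall>y\<in>F. x + y \<in> F \<and> x * y \<in> F)"

lemma subring_UNIV: "subring UNIV" and subring_Rats: "subring \<rat>"
  by (auto simp: subring_def)

definition vectors_over :: "real set \<Rightarrow> (real ^ 'n) set" where
  "vectors_over F = {a. \<forall>i. a $ i \<in> F}"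

lemma vectors_over_closed:
  assumes "subring F"
  shows "a \<in> vectors_over F \<Longrightarrow> c \<in> F \<Longrightarrow> c *\<^sub>R a \<in> vectors_over F"
    and "a \<in> vectors_over F \<Longrightarrow> b \<in> vectors_over F \<Longrightarrow> a + b \<in> vectors_over F"
    and "a \<in> vectors_over F \<Longrightarrow> - a \<in> vectors_over F"
  using assms by (auto simp: subring_def vectors_over_def)

lemma inner_vectors_over:
  assumes "subring F" "a \<in> vectors_over F" "b \<in> vectors_over F"
  shows "a \<bullet> b \<in> F"
proof -
  have "(\<Sum>i\<in>S. a $ i * b $ i) \<in> F" if "finite S" for S
    using that assms by (induction S) (auto simp: subring_def vectors_over_def)
  then show ?thesis
    by (simp add: inner_vec_def)
qed

definition polar :: "'a::real_inner set \<Rightarrow> 'a set" where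
  "polar H = {x. \<forall>a\<in>H. a \<bullet> x \<le> 0}"

definition polyhedral_cone_over :: "real set \<Rightarrow> (real ^ 'n) set \<Rightarrow> bool" where
  "polyhedral_cone_over F Q \<longleftrightarrow> (\<exists>H. finite H \<and> H \<subseteq> vectors_over F \<and> Q = polar H)"

lemma convex_cone_polar: "convex_cone (polar H)"
  by (auto simp: convex_cone_iff polar_def inner_right_distrib mult_nonneg_nonpos add_nonpos_nonpos)

lemma polyhedron_polar:
  fixes H :: "'a::euclidean_space set"
  assumes "finite H"
  shows "polyhedron (polar H)"
proof -
  have "polar H = (\<Inter>a\<in>H. {x. a \<bullet> x \<le> 0})"
    by (auto simp: polar_def)
  then show ?thesis
    using assms by (auto simp: polyhedron_halfspace_le)
qed

text \<open>Fourier--Motzkin elimination of \<open>s\<close> from the inequalities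
  \<open>a \<bullet> (x - s *\<^sub>R g) \<le> 0\<close> and \<open>s \<ge> 0\<close>.\<close>

lemma polyhedral_cone_over_add_ray:
  assumes F: "subring F" and Q: "polyhedral_cone_over F Q" and g: "g \<in> vectors_over F"
  shows "polyhedral_cone_over F {x + s *\<^sub>R g | x s. x \<in> Q \<and> 0 \<le> s}"
proof -
  obtain H where H: "finite H" "H \<subseteq> vectors_over F" "Q = polar H"
    using Q unfolding polyhedral_cone_over_def by blast
  \<comment> \<open>For \<open>a \<in> Hneg\<close> and \<open>h \<in> Hpos\<close> both multipliers
    are positive and the \<open>g\<close>-components cancel, so \<open>comb (a, h)\<close> does not
    see the ray.\<close>
  define comb where "comb = (\<lambda>(a, h). (- (a \<bullet> g)) *\<^sub>R h + (h \<bullet> g) *\<^sub>R a)"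
  define Hneg where "Hneg = {a \<in> H. a \<bullet> g < 0}"
  define Hpos where "Hpos = {h \<in> H. 0 < h \<bullet> g}"
  define H' where "H' = {a \<in> H. a \<bullet> g \<le> 0} \<union> comb ` (Hneg \<times> Hpos)"
  have "finite H'"
    using H(1) by (auto simp: H'_def Hneg_def Hpos_def)
  moreover have "H' \<subseteq> vectors_over F"
  proof -
    have "a \<bullet> g \<in> F" "- (a \<bullet> g) \<in> F" if "a \<in> H" for a
      using inner_vectors_over[OF F _ g] H(2) that F by (auto simp: subring_def)
    then have "comb (a, h) \<in> vectors_over F" if "a \<in> H" "h \<in> H" for a h
      unfolding comb_def prod.case using that H(2) by (intro vectors_over_closed[OF F]) auto
    then show ?thesis
      using H(2) by (auto simp: H'_def Hneg_def Hpos_def)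
  qed
  moreover have "{x + s *\<^sub>R g | x s. x \<in> Q \<and> 0 \<le> s} = polar H'"
  proof (intro equalityI subsetI)
    fix y assume "y \<in> {x + s *\<^sub>R g | x s. x \<in> Q \<and> 0 \<le> s}"
    then obtain x s where y: "y = x + s *\<^sub>R g" "0 \<le> s" and x: "\<And>a. a \<in> H \<Longrightarrow> a \<bullet> x \<le> 0"
      by (auto simp: H(3) polar_def)
    have "a \<bullet> y \<le> 0" if "a \<in> H" "a \<bullet> g \<le> 0" for a
      using that x[of a] y by (simp add: inner_right_distrib add_nonpos_nonpos mult_nonneg_nonpos)
    moreover have "comb (a, h) \<bullet> y \<le> 0" if "a \<in> Hneg" "h \<in> Hpos" for a h
    proof -
      have "comb (a, h) \<bullet> y = (- (a \<bullet> g)) * (h \<bullet> x) + (h \<bullet> g) * (a \<bullet> x)"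
        by (simp add: comb_def y inner_left_distrib inner_right_distrib algebra_simps)
      also have "\<dots> \<le> 0"
        using that x by (intro add_nonpos_nonpos mult_nonneg_nonpos) (auto simp: Hneg_def Hpos_def)
      finally show ?thesis .
    qed
    ultimately show "y \<in> polar H'"
      by (auto simp: polar_def H'_def)
  next
    fix y assume y: "y \<in> polar H'"
    \<comment> \<open>The inequalities with \<open>0 < h \<bullet> g\<close> bound \<open>s\<close>
      from below; this is the least nonnegative \<open>s\<close> meeting them all.\<close>
    define s where "s = Max (insert 0 ((\<lambda>h. (h \<bullet> y) / (h \<bullet> g)) ` Hpos))"
    have fin: "finite (insert 0 ((\<lambda>h. (h \<bullet> y) / (h \<bullet> g)) ` Hpos))"
      using H(1) by (auto simp: Hpos_def)
    have s0: "0 \<le> s"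
      unfolding s_def using fin by (intro Max_ge) auto
    have sh: "(h \<bullet> y) / (h \<bullet> g) \<le> s" if "h \<in> Hpos" for h
      unfolding s_def using fin that by (intro Max_ge) auto
    have s_in: "s \<in> insert 0 ((\<lambda>h. (h \<bullet> y) / (h \<bullet> g)) ` Hpos)"
      unfolding s_def using fin by (intro Max_in) auto
    have "a \<bullet> (y - s *\<^sub>R g) \<le> 0" if a: "a \<in> H" for a
    proof -
      consider "a \<bullet> g > 0" | "a \<bullet> g = 0" | "a \<bullet> g < 0"
        by linarith
      then show ?thesis
      proof cases
        case 1
        then show ?thesis
          using sh[of a] a by (simp add: Hpos_def inner_diff_right field_simps)
      next
        case 2
        then show ?thesis
          using y a by (simp add: polar_def H'_def inner_diff_right)
      next
        case 3
        then have ay: "a \<bullet> y \<le> 0"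
          using y a by (simp add: polar_def H'_def)
        show ?thesis
        \<comment> \<open>If \<open>s\<close> is not 0, the maximum is attained at some
          \<open>h\<close>, and \<open>comb (a, h)\<close> compares this lower bound for
          \<open>s\<close> with the upper bound coming from \<open>a\<close>.\<close>
        proof (cases "s = 0")
          case False
          then obtain h where h: "h \<in> Hpos" "s = (h \<bullet> y) / (h \<bullet> g)"
            using s_in by auto
          have "comb (a, h) \<bullet> y \<le> 0"
            using y h a 3 by (auto simp: polar_def H'_def Hneg_def)
          then have "(h \<bullet> g) * (a \<bullet> y) \<le> (a \<bullet> g) * (h \<bullet> y)"
            by (simp add: comb_def inner_left_distrib inner_diff_left)
          then have "(h \<bullet> g) * (a \<bullet> y) \<le> (h \<bullet> g) * (s * (a \<bullet> g))"
            using h by (simp add: Hpos_def mult.commute)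
          then have "a \<bullet> y \<le> s * (a \<bullet> g)"
            using h(1) by (simp add: Hpos_def)
          then show ?thesis
            by (simp add: inner_diff_right)
        qed (use ay in simp)
      qed
    qed
    then have "y - s *\<^sub>R g \<in> Q"
      by (simp add: H(3) polar_def)
    then show "y \<in> {x + s *\<^sub>R g | x s. x \<in> Q \<and> 0 \<le> s}"
      using s0 by (auto intro!: exI[of _ "y - s *\<^sub>R g"] exI[of _ s])
  qed
  ultimately show ?thesis
    unfolding polyhedral_cone_over_def by blast
qed

section \<open>Finitely generated cones and the Minkowski--Weyl theorem\<close>

lemma convex_cone_hull_insert:
  "convex_cone hull (insert g E) = {x + s *\<^sub>R g | x s. x \<in> convex_cone hull E \<and> 0 \<le> s}"
proof (intro equalityI)
  let ?R = "{x + s *\<^sub>R g | x s. x \<in> convex_cone hull E \<and> 0 \<le> s}"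
  have "x + 0 *\<^sub>R g \<in> ?R" if "x \<in> E" for x
    using that by (blast intro: hull_inc)
  moreover have "0 + 1 *\<^sub>R g \<in> ?R"
    using convex_cone_hull_contains_0 by (blast intro: zero_le_one)
  ultimately have "insert g E \<subseteq> ?R"
    by auto
  moreover have "convex_cone ?R"
  proof -
    have "0 \<in> ?R"
      using convex_cone_hull_contains_0[of E] by (auto intro!: exI[of _ 0])
    moreover have "u + v \<in> ?R" if "u \<in> ?R" "v \<in> ?R" for u v
    proof -
      from that obtain x s y r where "u = x + s *\<^sub>R g" "v = y + r *\<^sub>R g" "0 \<le> s" "0 \<le> r"
          "x \<in> convex_cone hull E" "y \<in> convex_cone hull E"
        by blast
      then show "u + v \<in> ?R"
        by (intro CollectI exI[of _ "x + y"] exI[of _ "s + r"])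
          (auto simp: convex_cone_hull_add algebra_simps)
    qed
    moreover have "c *\<^sub>R u \<in> ?R" if "u \<in> ?R" "0 \<le> c" for u c
    proof -
      from that obtain x s where "u = x + s *\<^sub>R g" "0 \<le> s" "x \<in> convex_cone hull E"
        by blast
      then show "c *\<^sub>R u \<in> ?R"
        using that(2) by (intro CollectI exI[of _ "c *\<^sub>R x"] exI[of _ "c * s"])
          (auto simp: convex_cone_hull_mul algebra_simps)
    qed
    ultimately show ?thesis
      unfolding convex_cone_iff by blast
  qed
  ultimately show "convex_cone hull (insert g E) \<subseteq> ?R"
    by (rule hull_minimal)
  show "?R \<subseteq> convex_cone hull (insert g E)"
    using hull_mono[OF subset_insertI[of E g], of convex_cone]
    by (auto intro!: convex_cone_hull_add convex_cone_hull_mul intro: hull_inc)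
qed

lemma polyhedral_cone_over_singleton_0:
  assumes "subring F"
  shows "polyhedral_cone_over F {0 :: real ^ 'n}"
proof -
  define H where "H = range (\<lambda>i::'n. axis i (1::real)) \<union> range (\<lambda>i. axis i (- 1))"
  have "finite H"
    by (simp add: H_def)
  moreover have "H \<subseteq> vectors_over F"
    using assms by (auto simp: H_def vectors_over_def axis_def subring_def)
  moreover have "polar H = {0}"
  proof -
    have "x = 0" if x: "x \<in> polar H" for x :: "real ^ 'n"
    proof -
      have "axis i 1 \<bullet> x \<le> 0" "axis i (- 1) \<bullet> x \<le> 0" for i
        using x by (auto simp: polar_def H_def)
      then show ?thesis
        by (simp add: inner_axis' vec_eq_iff order_antisym)
    qed
    then show ?thesis
      by (auto simp: polar_def)
  qed
  ultimately show ?thesis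
    unfolding polyhedral_cone_over_def by metis
qed

text \<open>One half of the Minkowski--Weyl theorem with control of the coefficients: start from the
  zero cone and adjoin the generators one at a time by elimination.\<close>

lemma polyhedral_cone_over_hull:
  assumes "subring F" "finite E" "E \<subseteq> vectors_over F"
  shows "polyhedral_cone_over F (convex_cone hull E)"
  using assms(2,3)
proof (induction E)
  case empty
  have "convex_cone hull {} = {0}"
    by (rule hull_unique) (auto simp: convex_cone_iff)
  then show ?case
    using polyhedral_cone_over_singleton_0[OF assms(1)] by simp
next
  case (insert g E)
  then show ?case
    unfolding convex_cone_hull_insert by (intro polyhedral_cone_over_add_ray assms(1)) auto
qed

text \<open>Each \<open>polar {x}\<close> is a convex cone, so it contains the hull as soon as it
  contains \<open>E\<close>.\<close>

lemma polar_convex_cone_hull: "polar (convex_cone hull E) = polar E"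
proof
  show "polar (convex_cone hull E) \<subseteq> polar E"
    by (auto simp: polar_def hull_inc)
  have "convex_cone hull E \<subseteq> polar {x}" if "x \<in> polar E" for x
    using that by (intro hull_minimal convex_cone_polar) (auto simp: polar_def inner_commute)
  then show "polar E \<subseteq> polar (convex_cone hull E)"
    by (auto simp: polar_def inner_commute)
qed

text \<open>If \<open>convex_cone hull H = polar G\<close>, then \<open>polar H = polar (polar G) = convex_cone hull G\<close>;
  the bipolar theorem for \<open>convex_cone hull G\<close> holds because that cone is itself a polar.\<close>

lemma polyhedral_cone_over_generators:
  assumes F: "subring F" and Q: "polyhedral_cone_over F Q"
  obtains G where "finite G" "G \<subseteq> vectors_over F" "0 \<notin> G" "Q = convex_cone hull G"
proof -
  obtain H where H: "finite H" "H \<subseteq> vectors_over F" "Q = polar H"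
    using Q unfolding polyhedral_cone_over_def by blast
  obtain G where G: "finite G" "G \<subseteq> vectors_over F" "convex_cone hull H = polar G"
    using polyhedral_cone_over_hull[OF F H(1,2)] unfolding polyhedral_cone_over_def by blast
  obtain L where L: "convex_cone hull G = polar L"
    using polyhedral_cone_over_hull[OF F G(1,2)] unfolding polyhedral_cone_over_def by blast
  have "polar (polar G) = convex_cone hull G"
  proof
    have "G \<subseteq> polar (polar G)"
      by (auto simp: polar_def inner_commute)
    then show "convex_cone hull G \<subseteq> polar (polar G)"
      by (intro hull_minimal convex_cone_polar)
    have "G \<subseteq> polar L"
      using L hull_subset[of G convex_cone] by simp
    then have "L \<subseteq> polar G"
      by (force simp: polar_def inner_commute)
    then show "polar (polar G) \<subseteq> convex_cone hull G"
      unfolding L by (auto simp: polar_def)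
  qed
  then have "Q = convex_cone hull G"
    using H(3) G(3) polar_convex_cone_hull by metis
  \<comment> \<open>The generator 0 is discarded because generic functionals must not vanish on any
    generator.\<close>
  also have "\<dots> = convex_cone hull (G - {0})"
  proof
    show "convex_cone hull G \<subseteq> convex_cone hull (G - {0})"
      by (intro hull_minimal convex_cone_convex_cone_hull)
        (metis DiffI convex_cone_hull_contains_0 hull_inc singletonD subsetI)
  qed (simp add: hull_mono)
  finally show thesis
    using that[of "G - {0}"] G by auto
qed

section \<open>Cutting cones along directions\<close>

text \<open>Finer than the relation in \<open>cong_mod_lines\<close>: with \<open>F = \<rat>\<close>
  every term is a rational polyhedron with a line, on which a generating function vanishes.\<close>

definition line_combination :: "real set \<Rightarrow> (real ^ 'n \<Rightarrow> real) \<Rightarrow> bool" where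
  "line_combination F = indicator_combination {Q. polyhedral_cone_over F Q \<and> contains_line Q}"

lemma contains_line_convex_cone:
  assumes "convex_cone C" "x \<in> C" "- x \<in> C" "x \<noteq> 0"
  shows "contains_line C"
proof -
  have "s *\<^sub>R x \<in> C" for s
    using convex_cone_scaleR[OF assms(1), of s x] convex_cone_scaleR[OF assms(1), of "- s" "- x"] assms
    by (cases "0 \<le> s") auto
  then show ?thesis
    unfolding contains_line_def using \<open>x \<noteq> 0\<close> by (intro exI[of _ 0] exI[of _ x]) auto
qed

text \<open>The values \<open>s\<close> with \<open>x + s *\<^sub>R g \<in> C\<close> form an interval; it contains \<open>0\<close> if and only if
  it meets both half-lines.\<close>

lemma indicator_cut:
  fixes g :: "'a::real_vector"
  assumes "convex_cone C"
  shows "indicator C x + indicator {y + s *\<^sub>R (- g) | y s. y \<in> {y + r *\<^sub>R g | y r. y \<in> C \<and> 0 \<le> r} \<and> 0 \<le> s} x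
    = (indicator {y + s *\<^sub>R g | y s. y \<in> C \<and> 0 \<le> s} x
      + indicator {y + s *\<^sub>R (- g) | y s. y \<in> C \<and> 0 \<le> s} x :: real)"
proof -
  let ?L = "{y + s *\<^sub>R (- g) | y s. y \<in> {y + r *\<^sub>R g | y r. y \<in> C \<and> 0 \<le> r} \<and> 0 \<le> s}"
  let ?A = "{y + s *\<^sub>R g | y s. y \<in> C \<and> 0 \<le> s}" and ?B = "{y + s *\<^sub>R (- g) | y s. y \<in> C \<and> 0 \<le> s}"
  have A: "?A \<subseteq> ?L" by force
  have B: "?B \<subseteq> ?L" by force
  have L: "?L \<subseteq> ?A \<union> ?B"
  proof
    fix z assume "z \<in> ?L"
    then obtain y r s where z: "z = y + r *\<^sub>R g + s *\<^sub>R (- g)" "y \<in> C" "0 \<le> r" "0 \<le> s"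
      by blast
    show "z \<in> ?A \<union> ?B"
    proof (cases "s \<le> r")
      case True
      have "z = y + (r - s) *\<^sub>R g" using z by (simp add: algebra_simps)
      then show ?thesis using z True by (intro UnI1 CollectI exI[of _ y] exI[of _ "r - s"]) auto
    next
      case False
      have "z = y + (s - r) *\<^sub>R (- g)" using z by (simp add: algebra_simps)
      then show ?thesis using z False by (intro UnI2 CollectI exI[of _ y] exI[of _ "s - r"]) auto
    qed
  qed
  have C: "C \<subseteq> ?A \<inter> ?B"
    by (force intro: exI[of _ 0])
  have "?A \<inter> ?B \<subseteq> C"
  proof
    fix z assume "z \<in> ?A \<inter> ?B"
    then obtain y s y' s' where z: "z = y + s *\<^sub>R g" "z = y' + s' *\<^sub>R (- g)" "y \<in> C" "y' \<in> C"
        "0 \<le> s" "0 \<le> s'"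
      by blast
    show "z \<in> C"
    proof (cases "s + s' = 0")
      case True
      then have "s = 0" using z by simp
      then show ?thesis using z by simp
    next
      case False
      then have pos: "0 < s + s'" using z by auto
      \<comment> \<open>Weighting the two representations of \<open>z\<close> by \<open>s'\<close>
        and \<open>s\<close> cancels \<open>g\<close> and leaves a nonnegative combination of
        \<open>y\<close> and \<open>y'\<close>.\<close>
      have "(s + s') *\<^sub>R z = s' *\<^sub>R (y + s *\<^sub>R g) + s *\<^sub>R (y' + s' *\<^sub>R (- g))"
        using z(1,2) by (metis add.commute scaleR_left_distrib)
      also have "\<dots> = s' *\<^sub>R y + s *\<^sub>R y'"
        by (simp add: algebra_simps)
      finally have "(1 / (s + s')) *\<^sub>R ((s + s') *\<^sub>R z) = (1 / (s + s')) *\<^sub>R (s' *\<^sub>R y + s *\<^sub>R y')"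
        by simp
      then have "z = (1 / (s + s')) *\<^sub>R (s' *\<^sub>R y + s *\<^sub>R y')"
        using pos by simp
      then show ?thesis
        using z pos convex_cone_add[OF assms] convex_cone_scaleR[OF assms] by simp
    qed
  qed
  with A B L C show ?thesis
    unfolding indicator_def by (smt (verit) Int_iff Un_iff subset_iff)
qed

text \<open>In \<open>indicator_cut\<close> the cone with both \<open>g\<close> and
  \<open>- g\<close> adjoined contains the line spanned by \<open>g\<close>, so its term drops
  out.\<close>

lemma line_combination_cut:
  assumes F: "subring F" and E: "finite E" "E \<subseteq> vectors_over F"
    and g: "g \<in> vectors_over F" "g \<noteq> 0"
  shows "line_combination F (\<lambda>x. indicator (convex_cone hull E) x
    - indicator (convex_cone hull (insert g E)) x - indicator (convex_cone hull (insert (- g) E)) x)"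
proof -
  let ?L = "convex_cone hull (insert (- g) (insert g E))"
  have "contains_line ?L"
    by (rule contains_line_convex_cone[OF convex_cone_convex_cone_hull _ _ g(2)]) (auto intro: hull_inc)
  moreover have "polyhedral_cone_over F ?L"
    using E g vectors_over_closed[OF F] by (intro polyhedral_cone_over_hull[OF F]) auto
  ultimately have "line_combination F (\<lambda>x. - 1 * indicator ?L x)"
    unfolding line_combination_def
    by (intro indicator_combination_cmult indicator_combination_indicator) auto
  moreover have "- 1 * indicator ?L x = (indicator (convex_cone hull E) x
    - indicator (convex_cone hull (insert g E)) x - indicator (convex_cone hull (insert (- g) E)) x :: real)" for x
    using indicator_cut[OF convex_cone_convex_cone_hull, of E x g]
    unfolding convex_cone_hull_insert[symmetric] by linarith
  ultimately show ?thesis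
    by simp
qed

text \<open>Induction on the directions \<open>G\<close> still to be cut. The signed directions
  already chosen form \<open>E\<close>, which is adjoined to every cone and describes the current
  chamber; up to sign, every generator lies in \<open>E\<close> or \<open>G\<close>. Accordingly
  only functionals positive on \<open>E\<close> are counted.\<close>

lemma line_combination_generators_aux:
  fixes X :: "'i \<Rightarrow> (real ^ 'n) set"
  assumes F: "subring F" and "finite G" "finite E" "finite N" "G \<subseteq> vectors_over F"
    "E \<subseteq> vectors_over F" "0 \<notin> G" "0 \<notin> E" "\<And>i. i \<in> N \<Longrightarrow> 0 \<notin> X i"
    and sub: "\<And>i. i \<in> N \<Longrightarrow> X i \<subseteq> E \<union> uminus ` E \<union> G \<union> uminus ` G"
    and count: "\<And>\<xi>. (\<forall>e\<in>E. 0 < \<xi> \<bullet> e) \<Longrightarrow> (\<forall>g\<in>G. \<xi> \<bullet> g \<noteq> 0) \<Longrightarrow>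
      (\<Sum>i | i \<in> N \<and> (\<forall>x\<in>X i. 0 < \<xi> \<bullet> x). c i) = 0"
  shows "line_combination F (\<lambda>x. \<Sum>i\<in>N. c i * indicator (convex_cone hull (X i \<union> E)) x)"
  using assms(2-)
proof (induction G arbitrary: E rule: finite_induct)
  case empty
  have fin: "finite (X i)" if "i \<in> N" for i
    using empty.prems(1,8) that by (auto intro: finite_subset)
  have vec: "X i \<subseteq> vectors_over F" if "i \<in> N" for i
    using empty.prems(4,8) that vectors_over_closed[OF F] by fastforce
  have over: "polyhedral_cone_over F (convex_cone hull (X i \<union> E))" if "i \<in> N" for i
    using fin vec empty.prems that by (intro polyhedral_cone_over_hull[OF F]) auto
  obtain H where H: "finite H" "convex_cone hull E = polar H"
    using polyhedral_cone_over_hull[OF F empty.prems(1,4)] unfolding polyhedral_cone_over_def by blast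
  \<comment> \<open>The negated sum of the outer normals is nonnegative on the cone of
    \<open>E\<close> and vanishes only where every normal does. So it is positive on
    \<open>E\<close> unless that cone contains a line.\<close>
  define \<xi> where "\<xi> = - (\<Sum>a\<in>H. a)"
  have line: "contains_line (convex_cone hull (X i \<union> E))"
    if "e \<in> X i \<union> E" "- e \<in> convex_cone hull E" "e \<noteq> 0" for i e
    using that hull_mono[of E "X i \<union> E" convex_cone]
    by (intro contains_line_convex_cone[OF convex_cone_convex_cone_hull, of e]) (auto intro: hull_inc)
  have lined: "line_combination F (\<lambda>x. c i * indicator (convex_cone hull (X i \<union> E)) x)"
    if "i \<in> N" "contains_line (convex_cone hull (X i \<union> E))" for i
    unfolding line_combination_def using that over
    by (intro indicator_combination_cmult indicator_combination_indicator) auto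
  show ?case
  proof (cases "\<forall>e\<in>E. 0 < \<xi> \<bullet> e")
    case False
    then obtain e where e: "e \<in> E" "\<xi> \<bullet> e \<le> 0"
      by force
    then have "e \<in> polar H"
      using H(2) by (metis hull_inc)
    then have le: "a \<bullet> e \<le> 0" if "a \<in> H" for a
      using that by (auto simp: polar_def)
    moreover have "(\<Sum>a\<in>H. - (a \<bullet> e)) = 0"
      using e le by (intro order_antisym sum_nonneg) (auto simp: \<xi>_def inner_sum_left sum_negf)
    ultimately have "a \<bullet> e = 0" if "a \<in> H" for a
      using that H(1) by (subst (asm) sum_nonneg_eq_0_iff) auto
    then have "- e \<in> convex_cone hull E"
      by (auto simp: H(2) polar_def)
    moreover have "e \<noteq> 0"
      using e empty.prems by auto
    ultimately have "contains_line (convex_cone hull (X i \<union> E))" for i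
      using line[of e i] e by auto
    then show ?thesis
      using lined unfolding line_combination_def by (intro indicator_combination_sum) auto
  next
    case True
    \<comment> \<open>All generators now lie in \<open>E\<close> up to sign. If \<xi> is positive on
      \<open>X i\<close>, then \<open>X i \<subseteq> E\<close> and the cone is the chamber itself;
      otherwise some \<open>x \<in> X i\<close> has \<open>- x \<in> E\<close> and the cone contains
      a line. The chamber is left with the counted coefficient, which is 0.\<close>
    define N' where "N' = {i \<in> N. \<forall>x\<in>X i. 0 < \<xi> \<bullet> x}"
    have "convex_cone hull (X i \<union> E) = convex_cone hull E" if "i \<in> N'" for i
    proof -
      have "X i \<subseteq> E"
        using empty.prems(8)[of i] that True by (force simp: N'_def)
      then show ?thesis
        by (simp add: Un_absorb1)
    qed
    then have "(\<Sum>i\<in>N'. c i * indicator (convex_cone hull (X i \<union> E)) x)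
      = (\<Sum>i\<in>N'. c i) * indicator (convex_cone hull E) x" for x
      by (simp add: sum_distrib_right)
    moreover have "(\<Sum>i\<in>N'. c i) = 0"
      unfolding N'_def using empty.prems(9)[of \<xi>] True by simp
    ultimately have "(\<Sum>i\<in>N. c i * indicator (convex_cone hull (X i \<union> E)) x)
      = (\<Sum>i\<in>N - N'. c i * indicator (convex_cone hull (X i \<union> E)) x)" for x
      using sum.subset_diff[of N' N "\<lambda>i. c i * indicator (convex_cone hull (X i \<union> E)) x"] empty.prems(2)
      by (auto simp: N'_def)
    moreover have "contains_line (convex_cone hull (X i \<union> E))" if i: "i \<in> N - N'" for i
    proof -
      obtain x where x: "x \<in> X i" "\<not> 0 < \<xi> \<bullet> x"
        using i by (auto simp: N'_def)
      then have "- x \<in> E"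
        using empty.prems(8)[of i] i True by force
      moreover have "x \<noteq> 0"
        using x empty.prems(7)[of i] i by auto
      ultimately show ?thesis
        using x by (intro line[of x]) (auto intro: hull_inc)
    qed
    ultimately show ?thesis
      using lined unfolding line_combination_def by (auto intro!: indicator_combination_sum)
  qed
next
  case (insert g G)
  have g: "g \<in> vectors_over F" "- g \<in> vectors_over F" "g \<noteq> 0"
    using insert.prems vectors_over_closed[OF F] by auto
  have fin: "finite (X i)" if "i \<in> N" for i
    by (rule finite_subset[OF insert.prems(8)[OF that]]) (use insert.prems insert.hyps in auto)
  have vec: "X i \<subseteq> vectors_over F" if "i \<in> N" for i
  proof -
    have "E \<union> uminus ` E \<union> insert g G \<union> uminus ` insert g G \<subseteq> vectors_over F"
      using insert.prems(3,4) by (auto intro!: vectors_over_closed(3)[OF F])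
    then show ?thesis
      using insert.prems(8)[OF that] by (rule order.trans[rotated])
  qed
  \<comment> \<open>Each sign of \<open>g\<close> opens a new chamber; a functional positive on it
    is nonzero at \<open>g\<close>, so the counting hypothesis carries over.\<close>
  have step: "line_combination F (\<lambda>x. \<Sum>i\<in>N. c i * indicator (convex_cone hull (X i \<union> insert h E)) x)"
    if h: "h = g \<or> h = - g" for h
  proof (rule insert.IH)
    show "X i \<subseteq> insert h E \<union> uminus ` insert h E \<union> G \<union> uminus ` G" if "i \<in> N" for i
    proof
      fix x assume "x \<in> X i"
      then have "x \<in> E \<or> x \<in> uminus ` E \<or> x \<in> G \<or> x \<in> uminus ` G \<or> x = g \<or> x = - g"
        using insert.prems(8)[OF that] by auto
      then show "x \<in> insert h E \<union> uminus ` insert h E \<union> G \<union> uminus ` G"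
        using h by auto
    qed
    fix \<xi> assume \<xi>: "\<forall>e\<in>insert h E. 0 < \<xi> \<bullet> e" "\<forall>g\<in>G. \<xi> \<bullet> g \<noteq> 0"
    then have "\<xi> \<bullet> g \<noteq> 0"
      using h by auto
    with \<xi> show "(\<Sum>i | i \<in> N \<and> (\<forall>x\<in>X i. 0 < \<xi> \<bullet> x). c i) = 0"
      by (intro insert.prems(9)) blast+
  next
    show "0 \<notin> insert h E"
      using h g(3) insert.prems(6) by auto
    show "0 \<notin> X i" if "i \<in> N" for i
      using insert.prems(7) that .
  qed (use insert.prems(1-5) g h in auto)
  have "line_combination F (\<lambda>x. \<Sum>i\<in>N. c i * (indicator (convex_cone hull (X i \<union> E)) x
    - indicator (convex_cone hull (insert g (X i \<union> E))) x - indicator (convex_cone hull (insert (- g) (X i \<union> E))) x))"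
    unfolding line_combination_def
  proof (intro indicator_combination_sum indicator_combination_cmult, fold line_combination_def)
    fix i assume "i \<in> N"
    then show "line_combination F (\<lambda>x. indicator (convex_cone hull (X i \<union> E)) x
      - indicator (convex_cone hull (insert g (X i \<union> E))) x - indicator (convex_cone hull (insert (- g) (X i \<union> E))) x)"
      using fin vec insert.prems g by (intro line_combination_cut[OF F]) auto
  qed
  from indicator_combination_add[OF this[unfolded line_combination_def]
      indicator_combination_add[OF step[of g, unfolded line_combination_def]
        step[of "- g", unfolded line_combination_def]]]
  show ?case
    unfolding line_combination_def by (simp add: algebra_simps sum_subtractf sum.distrib)
qed

text \<open>Cutting along all generators turns every cone into the sum of the chambers containing it,
  modulo lines, and a functional that is positive on a chamber detects which cones lie in it.\<close>

proposition line_combination_generators: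
  fixes X :: "'i \<Rightarrow> (real ^ 'n) set"
  assumes F: "subring F" and N: "finite N"
    and X: "\<And>i. i \<in> N \<Longrightarrow> finite (X i)" "\<And>i. i \<in> N \<Longrightarrow> X i \<subseteq> vectors_over F" "\<And>i. i \<in> N \<Longrightarrow> 0 \<notin> X i"
    and count: "\<And>\<xi>. (\<forall>i\<in>N. \<forall>x\<in>X i. \<xi> \<bullet> x \<noteq> 0) \<Longrightarrow>
      (\<Sum>i | i \<in> N \<and> (\<forall>x\<in>X i. 0 < \<xi> \<bullet> x). c i) = 0"
  shows "line_combination F (\<lambda>x. \<Sum>i\<in>N. c i * indicator (convex_cone hull (X i)) x)"
proof -
  have "line_combination F (\<lambda>x. \<Sum>i\<in>N. c i * indicator (convex_cone hull (X i \<union> {})) x)"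
    by (rule line_combination_generators_aux[OF F, of "\<Union>i\<in>N. X i"]) (use N X count in auto)
  then show ?thesis
    by simp
qed

lemma line_combination_polyhedra:
  fixes g :: "real ^ 'n \<Rightarrow> real"
  assumes "line_combination F g"
  shows "indicator_combination {Q. polyhedron Q \<and> contains_line Q} g"
proof -
  have "polyhedron Q" if "polyhedral_cone_over F Q" for Q :: "(real ^ 'n) set"
    using that polyhedron_polar unfolding polyhedral_cone_over_def by blast
  then show ?thesis
    using assms unfolding line_combination_def by (elim indicator_combination_mono) blast
qed

section \<open>Functionals positive on a cone\<close>

lemma inner_pos_convex_cone_hull:
  assumes "\<And>x. x \<in> X \<Longrightarrow> 0 < \<xi> \<bullet> x" "y \<in> convex_cone hull X" "y \<noteq> 0"
  shows "0 < \<xi> \<bullet> y"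
proof -
  \<comment> \<open>With 0 added, the set where \<xi> is positive is a convex cone, so checking the
    generators is enough.\<close>
  have "convex_cone {x. x = 0 \<or> 0 < \<xi> \<bullet> x}"
    by (auto simp: convex_cone_iff inner_right_distrib order_le_less)
  then have "convex_cone hull X \<subseteq> {x. x = 0 \<or> 0 < \<xi> \<bullet> x}"
    using assms(1) by (intro hull_minimal) auto
  then show ?thesis
    using assms(2,3) by auto
qed

text \<open>For a closed convex cone in finite dimension: \<xi> lies in the interior of the dual
  cone.\<close>

definition positive_on :: "'a::real_inner \<Rightarrow> 'a set \<Rightarrow> bool" where
  "positive_on \<xi> C \<longleftrightarrow> (\<forall>x\<in>C. x \<noteq> 0 \<longrightarrow> 0 < \<xi> \<bullet> x)"

lemma positive_on_hull:
  assumes "0 \<notin> X"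
  shows "positive_on \<xi> (convex_cone hull X) \<longleftrightarrow> (\<forall>x\<in>X. 0 < \<xi> \<bullet> x)"
proof
  assume "positive_on \<xi> (convex_cone hull X)"
  then show "\<forall>x\<in>X. 0 < \<xi> \<bullet> x"
    using assms unfolding positive_on_def by (metis hull_inc)
next
  assume "\<forall>x\<in>X. 0 < \<xi> \<bullet> x"
  then show "positive_on \<xi> (convex_cone hull X)"
    unfolding positive_on_def using inner_pos_convex_cone_hull[of X \<xi>] by blast
qed

text \<open>Only functionals vanishing on no generator have to be counted; the hypothesis \<open>count\<close>
  expresses this without choosing generators.\<close>

lemma line_combination_cones:
  fixes C :: "'i \<Rightarrow> (real ^ 'n) set"
  assumes F: "subring F" and N: "finite N" and C: "\<And>i. i \<in> N \<Longrightarrow> polyhedral_cone_over F (C i)"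
    and count: "\<And>\<xi>. (\<And>i. i \<in> N \<Longrightarrow> (\<And>x. x \<in> C i \<Longrightarrow> 0 \<le> \<xi> \<bullet> x) \<Longrightarrow> positive_on \<xi> (C i)) \<Longrightarrow>
      (\<Sum>i | i \<in> N \<and> positive_on \<xi> (C i). c i) = 0"
  shows "line_combination F (\<lambda>x. \<Sum>i\<in>N. c i * indicator (C i) x)"
proof -
  have "\<forall>i\<in>N. \<exists>X. finite X \<and> X \<subseteq> vectors_over F \<and> 0 \<notin> X \<and> C i = convex_cone hull X"
    using C polyhedral_cone_over_generators[OF F] by metis
  then obtain X where X: "\<And>i. i \<in> N \<Longrightarrow> finite (X i)" "\<And>i. i \<in> N \<Longrightarrow> X i \<subseteq> vectors_over F"
      "\<And>i. i \<in> N \<Longrightarrow> 0 \<notin> X i" "\<And>i. i \<in> N \<Longrightarrow> C i = convex_cone hull X i"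
    by metis
  have pos: "positive_on \<xi> (C i) \<longleftrightarrow> (\<forall>x\<in>X i. 0 < \<xi> \<bullet> x)" if "i \<in> N" for i \<xi>
    using X(3,4) that by (simp add: positive_on_hull)
  have "(\<Sum>i | i \<in> N \<and> (\<forall>x\<in>X i. 0 < \<xi> \<bullet> x). c i) = 0"
    if generic: "\<forall>i\<in>N. \<forall>x\<in>X i. \<xi> \<bullet> x \<noteq> 0" for \<xi>
  proof -
    have "positive_on \<xi> (C i)" if "i \<in> N" "\<And>x. x \<in> C i \<Longrightarrow> 0 \<le> \<xi> \<bullet> x" for i
      unfolding pos[OF that(1)]
    proof
      fix x assume "x \<in> X i"
      moreover from this have "x \<in> C i"
        unfolding X(4)[OF that(1)] by (rule hull_inc)
      ultimately show "0 < \<xi> \<bullet> x"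
        using generic that by (force simp: order_less_le)
    qed
    then have "(\<Sum>i | i \<in> N \<and> positive_on \<xi> (C i). c i) = 0"
      by (rule count)
    moreover have "{i. i \<in> N \<and> positive_on \<xi> (C i)} = {i. i \<in> N \<and> (\<forall>x\<in>X i. 0 < \<xi> \<bullet> x)}"
      using pos by blast
    ultimately show ?thesis
      by simp
  qed
  then have "line_combination F (\<lambda>x. \<Sum>i\<in>N. c i * indicator (convex_cone hull X i) x)"
    using X(1-3) by (intro line_combination_generators[OF F N]) auto
  moreover have "(\<Sum>i\<in>N. c i * indicator (convex_cone hull X i) x) = (\<Sum>i\<in>N. c i * indicator (C i) x)" for x
    using X(4) by (intro sum.cong) auto
  ultimately show ?thesis
    by simp
qed

section \<open>Feasible cones of polyhedra\<close>

lemma fcone_step: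
  assumes "u \<in> fcone P v"
  obtains \<delta> where "0 < \<delta>" "v + \<delta> *\<^sub>R u \<in> P"
proof -
  have "\<forall>\<^sub>F \<delta> in at_right 0. 0 < \<delta> \<and> v + \<delta> *\<^sub>R u \<in> P"
    using assms unfolding fcone_def by (simp add: eventually_conj_iff eventually_at_right_less)
  then show thesis
    using that eventually_happens by force
qed

text \<open>Rows active at \<open>w\<close> leave no slack for a step along \<open>u\<close>;
  inactive rows have positive slack and survive small steps. As there are finitely many rows, one
  bound on the step serves all.\<close>

lemma fcone_polyhedron:
  fixes A :: "real ^ 'n ^ 'm"
  assumes w: "A *v w \<le> \<beta>"
  shows "fcone {x. A *v x \<le> \<beta>} w = {u. \<forall>i. (A *v w) $ i = \<beta> $ i \<longrightarrow> (A *v u) $ i \<le> 0}"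
proof (intro equalityI subsetI CollectI)
  fix u assume "u \<in> fcone {x. A *v x \<le> \<beta>} w"
  then obtain \<delta> where \<delta>: "0 < \<delta>" "A *v (w + \<delta> *\<^sub>R u) \<le> \<beta>"
    by (auto elim: fcone_step)
  have "(A *v w) $ i + \<delta> * (A *v u) $ i \<le> \<beta> $ i" for i
    using \<delta>(2) by (simp add: less_eq_vec_def matrix_vector_right_distrib matrix_vector_mult_scaleR)
  then show "\<forall>i. (A *v w) $ i = \<beta> $ i \<longrightarrow> (A *v u) $ i \<le> 0"
    using \<delta>(1) by (metis add_le_same_cancel1 mult_le_0_iff not_less)
next
  fix u assume u: "u \<in> {u. \<forall>i. (A *v w) $ i = \<beta> $ i \<longrightarrow> (A *v u) $ i \<le> 0}"
  have "\<forall>\<^sub>F \<delta> in at_right 0. (A *v w) $ i + \<delta> * (A *v u) $ i \<le> \<beta> $ i" for i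
  proof (cases "(A *v w) $ i = \<beta> $ i")
    case True
    then have "(A *v u) $ i \<le> 0"
      using u by auto
    then have "(A *v w) $ i + \<delta> * (A *v u) $ i \<le> \<beta> $ i" if "0 < \<delta>" for \<delta>
      using True that by (simp add: mult_nonneg_nonpos)
    then show ?thesis
      by (rule eventually_mono[OF eventually_at_right_less])
  next
    case False
    then have "(A *v w) $ i + 0 * (A *v u) $ i < \<beta> $ i"
      using w by (simp add: less_eq_vec_def order_less_le)
    moreover have "((\<lambda>\<delta>. (A *v w) $ i + \<delta> * (A *v u) $ i) \<longlongrightarrow> (A *v w) $ i + 0 * (A *v u) $ i) (at_right 0)"
      by (intro tendsto_intros)
    ultimately show ?thesis
      using order_tendstoD(2) by (fastforce elim: eventually_mono)
  qed
  then have "\<forall>\<^sub>F \<delta> in at_right 0. \<forall>i. (A *v w) $ i + \<delta> * (A *v u) $ i \<le> \<beta> $ i"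
    by (rule eventually_all_finite)
  then show "u \<in> fcone {x. A *v x \<le> \<beta>} w"
    unfolding fcone_def
    by (simp add: less_eq_vec_def matrix_vector_right_distrib matrix_vector_mult_scaleR)
qed

lemma polyhedral_cone_over_fcone:
  fixes A :: "real ^ 'n ^ 'm"
  assumes "A *v w \<le> \<beta>"
  shows "polyhedral_cone_over UNIV (fcone {x. A *v x \<le> \<beta>} w)"
proof -
  have "fcone {x. A *v x \<le> \<beta>} w = polar ((\<lambda>i. A $ i) ` {i. (A *v w) $ i = \<beta> $ i})"
    unfolding fcone_polyhedron[OF assms] by (auto simp: polar_def matrix_vector_mul_component)
  then show ?thesis
    unfolding polyhedral_cone_over_def
    by (intro exI[of _ "(\<lambda>i. A $ i) ` {i. (A *v w) $ i = \<beta> $ i}"]) (simp add: vectors_over_def)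
qed

lemma diff_in_fcone:
  fixes A :: "real ^ 'n ^ 'm"
  assumes "A *v w \<le> \<beta>" "A *v x \<le> \<beta>"
  shows "x - w \<in> fcone {x. A *v x \<le> \<beta>} w"
  unfolding fcone_polyhedron[OF assms(1)]
proof (intro CollectI allI impI)
  fix i assume "(A *v w) $ i = \<beta> $ i"
  moreover have "(A *v x) $ i \<le> \<beta> $ i"
    using assms(2) by (simp add: less_eq_vec_def)
  ultimately show "(A *v (x - w)) $ i \<le> 0"
    by (simp add: matrix_vector_mult_diff_distrib)
qed

text \<open>Otherwise \<open>w\<close> would be the midpoint of two distinct points of
  \<open>S\<close>, reached along \<open>u\<close> and \<open>- u\<close>.\<close>

lemma fcone_extreme_point_pointed:
  assumes "w extreme_point_of S" "u \<in> fcone S w" "- u \<in> fcone S w"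
  shows "u = 0"
proof (rule ccontr)
  assume "u \<noteq> 0"
  have "\<forall>\<^sub>F \<delta> in at_right 0. 0 < \<delta> \<and> w + \<delta> *\<^sub>R u \<in> S \<and> w - \<delta> *\<^sub>R u \<in> S"
    using assms(2,3) unfolding fcone_def by (simp add: eventually_conj_iff eventually_at_right_less)
  then obtain \<delta> :: real where \<delta>: "0 < \<delta>" "w + \<delta> *\<^sub>R u \<in> S" "w - \<delta> *\<^sub>R u \<in> S"
    using eventually_happens by force
  have "midpoint (w + \<delta> *\<^sub>R u) (w - \<delta> *\<^sub>R u) = w"
    by (simp add: midpoint_def scaleR_2[symmetric])
  moreover have "w + \<delta> *\<^sub>R u \<noteq> w - \<delta> *\<^sub>R u"
  proof
    assume "w + \<delta> *\<^sub>R u = w - \<delta> *\<^sub>R u"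
    then have "(2 * \<delta>) *\<^sub>R u = 0"
      by (simp add: scaleR_2[symmetric] eq_neg_iff_add_eq_0 flip: scaleR_scaleR)
    then show False
      using \<delta>(1) \<open>u \<noteq> 0\<close> by simp
  qed
  ultimately have "w \<in> open_segment (w + \<delta> *\<^sub>R u) (w - \<delta> *\<^sub>R u)"
    by (metis midpoint_in_open_segment)
  then show False
    using assms(1) \<delta> by (auto simp: extreme_point_of_def)
qed

text \<open>If \<open>v\<close> is strictly between \<open>x\<close> and \<open>y\<close>, then
  \<open>x - v\<close> and \<open>y - v\<close> are positive multiples of \<open>x - y\<close> and
  \<open>y - x\<close>, against pointedness.\<close>

lemma extreme_point_ofI_pointed_cone:
  assumes "v \<in> S" "convex_cone K" "\<And>x. x \<in> S \<Longrightarrow> x - v \<in> K"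
    and pointed: "\<And>u. u \<in> K \<Longrightarrow> - u \<in> K \<Longrightarrow> u = 0"
  shows "v extreme_point_of S"
  unfolding extreme_point_of_def
proof (intro conjI ballI notI)
  fix x y assume xy: "x \<in> S" "y \<in> S" "v \<in> open_segment x y"
  then obtain s where s: "0 < s" "s < 1" "v = (1 - s) *\<^sub>R x + s *\<^sub>R y" and ne: "x \<noteq> y"
    by (auto simp: in_segment)
  have "s *\<^sub>R (x - y) = x - v" "(1 - s) *\<^sub>R (y - x) = y - v"
    by (auto simp: s(3) algebra_simps)
  then have "s *\<^sub>R (x - y) \<in> K" "(1 - s) *\<^sub>R (y - x) \<in> K"
    using assms(3) xy by auto
  then have "(1 / s) *\<^sub>R (s *\<^sub>R (x - y)) \<in> K" "(1 / (1 - s)) *\<^sub>R ((1 - s) *\<^sub>R (y - x)) \<in> K"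
    using s(1,2) convex_cone_scaleR[OF assms(2)] by (metis diff_gt_0_iff_gt less_imp_le zero_less_divide_1_iff)+
  then have "x - y \<in> K" "- (x - y) \<in> K"
    using s by simp_all
  with pointed[of "x - y"] ne show False
    by simp
qed (rule assms(1))

text \<open>An inequality violated by \<open>x - v\<close> is not active at \<open>v\<close>, hence not at the nearby points.\<close>

lemma diff_limit_in_fcone:
  fixes A :: "real ^ 'n ^ 'm"
  assumes "F \<noteq> bot" and \<beta>: "(\<beta> \<longlongrightarrow> b) F" and \<omega>: "(\<omega> \<longlongrightarrow> v) F"
    and ev: "\<forall>\<^sub>F t in F. A *v \<omega> t \<le> \<beta> t \<and> fcone {x. A *v x \<le> \<beta> t} (\<omega> t) = K"
  shows "A *v v \<le> b" and "A *v x \<le> b \<Longrightarrow> x - v \<in> K"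
proof -
  have lim: "((\<lambda>t. (A *v \<omega> t) $ i) \<longlongrightarrow> (A *v v) $ i) F" "((\<lambda>t. \<beta> t $ i) \<longlongrightarrow> b $ i) F" for i
    unfolding matrix_vector_mul_component using \<omega> \<beta> by (auto intro!: tendsto_intros)
  show "A *v v \<le> b"
    unfolding less_eq_vec_def
  proof
    fix i
    have "\<forall>\<^sub>F t in F. (A *v \<omega> t) $ i \<le> \<beta> t $ i"
      using ev by eventually_elim (simp add: less_eq_vec_def)
    then show "(A *v v) $ i \<le> b $ i"
      by (rule tendsto_le[OF assms(1) lim(2) lim(1)])
  qed
  assume x: "A *v x \<le> b"
  have "\<forall>\<^sub>F t in F. (A *v \<omega> t) $ i = \<beta> t $ i \<longrightarrow> (A *v (x - v)) $ i \<le> 0" for i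
  proof (cases "(A *v (x - v)) $ i \<le> 0")
    case False
    then have "(A *v v) $ i < (A *v x) $ i"
      by (simp add: matrix_vector_mult_diff_distrib)
    also have "\<dots> \<le> b $ i"
      using x by (simp add: less_eq_vec_def)
    finally have "0 < b $ i - (A *v v) $ i"
      by simp
    then have "\<forall>\<^sub>F t in F. 0 < \<beta> t $ i - (A *v \<omega> t) $ i"
      by (rule order_tendstoD(1)[OF tendsto_diff[OF lim(2) lim(1)]])
    then show ?thesis
      by eventually_elim simp
  qed simp
  then have "\<forall>\<^sub>F t in F. \<forall>i. (A *v \<omega> t) $ i = \<beta> t $ i \<longrightarrow> (A *v (x - v)) $ i \<le> 0"
    by (rule eventually_all_finite)
  then have "\<forall>\<^sub>F t in F. x - v \<in> K"
    using ev by eventually_elim (use fcone_polyhedron in blast)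
  then show "x - v \<in> K"
    using \<open>F \<noteq> bot\<close> by (simp add: eventually_const_iff)
qed

text \<open>When the feasible cone is pointed, the active rows have trivial common kernel, so the
  active entries of \<beta> control \<open>w\<close>. There are finitely many sets of rows, whence a
  constant independent of \<beta>.\<close>

lemma norm_vertex_bound:
  fixes A :: "real ^ 'n ^ 'm"
  obtains c where "0 < c" "\<And>w \<beta>. A *v w \<le> \<beta> \<Longrightarrow>
    (\<And>u. u \<in> fcone {x. A *v x \<le> \<beta>} w \<Longrightarrow> - u \<in> fcone {x. A *v x \<le> \<beta>} w \<Longrightarrow> u = 0) \<Longrightarrow>
    c * norm w \<le> norm \<beta>"
proof -
  define L where "L I x = (\<chi> i. if i \<in> I then (A *v x) $ i else 0)" for I x
  have "\<exists>c>0. inj (L I) \<longrightarrow> (\<forall>x. c * norm x \<le> norm (L I x))" for I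
  proof (cases "inj (L I)")
    case True
    have "linear (L I)"
      by (rule linearI) (auto simp: L_def vec_eq_iff matrix_vector_right_distrib matrix_vector_mult_scaleR)
    then show ?thesis
      using linear_inj_bounded_below_pos[OF _ True] by metis
  qed (auto intro: exI[of _ 1])
  then obtain c where c: "\<And>I. 0 < c I" "\<And>I x. inj (L I) \<Longrightarrow> c I * norm x \<le> norm (L I x)"
    by metis
  show thesis
  proof
    show "0 < Min (range c)"
      using c(1) by simp
    fix w \<beta> assume w: "A *v w \<le> \<beta>"
      and pointed: "\<And>u. u \<in> fcone {x. A *v x \<le> \<beta>} w \<Longrightarrow> - u \<in> fcone {x. A *v x \<le> \<beta>} w \<Longrightarrow> u = 0"
    define I where "I = {i. (A *v w) $ i = \<beta> $ i}"
    have "inj (L I)"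
    proof (rule injI)
      fix x y assume "L I x = L I y"
      then have eq: "L I x $ i = L I y $ i" for i
        by simp
      have "(A *v x) $ i = (A *v y) $ i" if "i \<in> I" for i
        using that eq[of i] by (simp add: L_def)
      then have "x - y \<in> fcone {x. A *v x \<le> \<beta>} w" "- (x - y) \<in> fcone {x. A *v x \<le> \<beta>} w"
        unfolding fcone_polyhedron[OF w] by (auto simp: I_def matrix_vector_mult_diff_distrib)
      then show "x = y"
        using pointed[of "x - y"] by simp
    qed
    have "Min (range c) * norm w \<le> c I * norm w"
      by (intro mult_right_mono Min_le) auto
    also have "\<dots> \<le> norm (L I w)"
      using c(2)[OF \<open>inj (L I)\<close>] .
    also have "\<dots> \<le> norm \<beta>"
      by (rule norm_le_componentwise_cart) (auto simp: L_def I_def)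
    finally show "Min (range c) * norm w \<le> norm \<beta>" .
  qed
qed

text \<open>Two cluster points \<open>v\<close>, \<open>v'\<close> satisfy \<open>v' - v \<in> K\<close> and \<open>v - v' \<in> K\<close>.\<close>

lemma vertex_convergent:
  fixes A :: "real ^ 'n ^ 'm" and \<beta> :: "real \<Rightarrow> real ^ 'm"
  assumes nontriv: "at a within T \<noteq> bot" and \<beta>: "(\<beta> \<longlongrightarrow> b) (at a within T)"
    and w: "\<And>t. t \<in> T \<Longrightarrow> t \<noteq> a \<Longrightarrow> A *v \<omega> t \<le> \<beta> t"
    and K: "\<And>t. t \<in> T \<Longrightarrow> t \<noteq> a \<Longrightarrow> fcone {x. A *v x \<le> \<beta> t} (\<omega> t) = K"
    and pointed: "\<And>u. u \<in> K \<Longrightarrow> - u \<in> K \<Longrightarrow> u = 0"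
  obtains v where "(\<omega> \<longlongrightarrow> v) (at a within T)"
proof -
  \<comment> \<open>Bounded right-hand sides bound the vertices, so every sequence tending to
    \<open>a\<close> has a subsequence to which \<open>diff_limit_in_fcone\<close> applies.\<close>
  have cluster: "\<exists>v r. strict_mono r \<and> (\<omega> \<circ> X \<circ> r) \<longlonglongrightarrow> v \<and> A *v v \<le> b \<and> (\<forall>x. A *v x \<le> b \<longrightarrow> x - v \<in> K)"
    if X: "\<And>n. X n \<in> T - {a}" "X \<longlonglongrightarrow> a" for X
  proof -
    have lim: "(\<beta> \<circ> X) \<longlonglongrightarrow> b"
      using \<beta> X unfolding tendsto_at_iff_sequentially by blast
    then obtain M where M: "norm (\<beta> (X n)) \<le> M" for n
      using convergent_imp_bounded[OF lim] unfolding bounded_iff by auto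
    obtain c where c: "0 < c" "\<And>w \<beta>. A *v w \<le> \<beta> \<Longrightarrow>
      (\<And>u. u \<in> fcone {x. A *v x \<le> \<beta>} w \<Longrightarrow> - u \<in> fcone {x. A *v x \<le> \<beta>} w \<Longrightarrow> u = 0) \<Longrightarrow>
      c * norm w \<le> norm \<beta>"
      using norm_vertex_bound[of A] by blast
    have "(\<omega> \<circ> X) n \<in> cball 0 (M / c)" for n
    proof -
      have "c * norm (\<omega> (X n)) \<le> norm (\<beta> (X n))"
        using X(1)[of n] w K pointed by (intro c(2)) auto
      also have "\<dots> \<le> M"
        by (rule M)
      finally show ?thesis
        using c(1) by (simp add: field_simps)
    qed
    then obtain v r where r: "strict_mono r" "(\<omega> \<circ> X \<circ> r) \<longlonglongrightarrow> v"
      using compact_cball[of 0 "M / c"] unfolding compact_def by (metis comp_assoc)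
    have \<beta>r: "(\<beta> \<circ> X \<circ> r) \<longlonglongrightarrow> b"
      using LIMSEQ_subseq_LIMSEQ[OF lim r(1)] .
    have "\<forall>\<^sub>F n in sequentially. A *v (\<omega> \<circ> X \<circ> r) n \<le> (\<beta> \<circ> X \<circ> r) n \<and>
        fcone {x. A *v x \<le> (\<beta> \<circ> X \<circ> r) n} ((\<omega> \<circ> X \<circ> r) n) = K"
      using X(1) w K by (intro always_eventually) auto
    from diff_limit_in_fcone[OF _ \<beta>r r(2) this] r show ?thesis
      by auto
  qed
  have "a islimpt T"
    using nontriv by (simp add: trivial_limit_within)
  then obtain X where X: "\<And>n. X n \<in> T - {a}" "X \<longlonglongrightarrow> a"
    unfolding islimpt_sequential by blast
  obtain v where v: "A *v v \<le> b" "\<And>x. A *v x \<le> b \<Longrightarrow> x - v \<in> K"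
    using cluster[OF X] by blast
  have "(\<omega> \<longlongrightarrow> v) (at a within T)"
  proof (rule ccontr)
    assume "\<not> (\<omega> \<longlongrightarrow> v) (at a within T)"
    then obtain e where "0 < e" and e: "\<not> (\<forall>\<^sub>F t in at a within T. dist (\<omega> t) v < e)"
      unfolding tendsto_iff by blast
    \<comment> \<open>If convergence fails, some sequence tending to \<open>a\<close> keeps distance
      at least \<open>e\<close> from \<open>v\<close>, yet has a cluster point, necessarily
      \<open>v\<close>.\<close>
    have "\<exists>t\<in>T. t \<noteq> a \<and> dist t a < 1 / real (Suc n) \<and> \<not> dist (\<omega> t) v < e" for n
      using e unfolding eventually_at by (metis of_nat_0_less_iff zero_less_Suc zero_less_divide_1_iff)
    then obtain Y where Y: "\<And>n. Y n \<in> T - {a}" "\<And>n. dist (Y n) a < 1 / real (Suc n)"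
        "\<And>n. \<not> dist (\<omega> (Y n)) v < e"
      by (metis Diff_iff singletonD)
    have "Y \<longlonglongrightarrow> a"
    proof (rule metric_LIMSEQ_I)
      fix r :: real assume "0 < r"
      then obtain N where "inverse (real (Suc N)) < r"
        using reals_Archimedean by blast
      then have "dist (Y n) a < r" if "N \<le> n" for n
      proof -
        have "1 / real (Suc n) \<le> inverse (real (Suc N))"
          using that by (simp add: field_simps)
        then show ?thesis
          using Y(2)[of n] \<open>inverse (real (Suc N)) < r\<close> by linarith
      qed
      then show "\<exists>N. \<forall>n\<ge>N. dist (Y n) a < r"
        by blast
    qed
    from cluster[of Y, OF Y(1) this] obtain v' r where v': "(\<omega> \<circ> Y \<circ> r) \<longlonglongrightarrow> v'" "A *v v' \<le> b" "\<And>x. A *v x \<le> b \<Longrightarrow> x - v' \<in> K"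
      by blast
    have "v' = v"
      using pointed[of "v' - v"] v v' by simp
    then have "\<forall>\<^sub>F n in sequentially. dist ((\<omega> \<circ> Y \<circ> r) n) v < e"
      using v'(1) \<open>0 < e\<close> unfolding tendsto_iff by blast
    then show False
      using Y(3) by (auto simp: eventually_sequentially)
  qed
  then show thesis
    by (rule that)
qed

text \<open>Positivity on the recession directions makes sublevel sets of \<xi> in the polyhedron
  compact. The face of minimizers is then compact and convex, so it has an extreme point, which is
  extreme in the whole polyhedron.\<close>

lemma exists_minimizing_vertex:
  fixes A :: "real ^ 'n ^ 'm"
  assumes ne: "{x. A *v x \<le> \<beta>} \<noteq> {}"
    and pos: "\<And>u. A *v u \<le> 0 \<Longrightarrow> u \<noteq> 0 \<Longrightarrow> 0 < \<xi> \<bullet> u"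
  shows "\<exists>w. w extreme_point_of {x. A *v x \<le> \<beta>} \<and> (\<forall>x. A *v x \<le> \<beta> \<longrightarrow> \<xi> \<bullet> w \<le> \<xi> \<bullet> x)"
proof -
  let ?P = "{x. A *v x \<le> \<beta>}"
  obtain p where p: "A *v p \<le> \<beta>"
    using ne by auto
  \<comment> \<open>A positively homogeneous measure of how far \<open>u\<close> is from being a
    recession direction with \<open>\<xi> \<bullet> u \<le> 0\<close>. It vanishes only at 0, so its
    minimum on the unit sphere bounds it below by a multiple of the norm.\<close>
  define h where "h u = (\<Sum>i\<in>UNIV. max 0 ((A *v u) $ i)) + max 0 (\<xi> \<bullet> u)" for u
  have h0: "0 \<le> h u" for u
    by (auto simp: h_def intro!: add_nonneg_nonneg sum_nonneg)
  have h_pos: "0 < h u" if "u \<noteq> 0" for u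
  proof (cases "A *v u \<le> 0")
    case True
    then show ?thesis
      using pos[OF True that] by (auto simp: h_def intro!: add_nonneg_pos sum_nonneg)
  next
    case False
    then obtain i where "0 < (A *v u) $ i"
      by (auto simp: less_eq_vec_def not_le)
    then have "0 < (\<Sum>i\<in>UNIV. max 0 ((A *v u) $ i))"
      by (intro sum_pos2[of UNIV i]) auto
    then show ?thesis
      by (auto simp: h_def intro!: add_pos_nonneg)
  qed
  have "continuous_on (sphere 0 1) h"
    unfolding h_def matrix_vector_mul_component by (intro continuous_intros)
  moreover have "sphere 0 1 \<noteq> ({} :: (real ^ 'n) set)"
    by simp
  ultimately obtain u0 where u0: "u0 \<in> sphere 0 1" "\<And>u. u \<in> sphere 0 1 \<Longrightarrow> h u0 \<le> h u"
    using continuous_attains_inf[OF compact_sphere] by metis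
  have "0 < h u0"
    using u0(1) by (intro h_pos) auto
  have h_ge: "h u0 * norm x \<le> h x" for x
  proof (cases "x = 0")
    case False
    have "h u0 * norm x \<le> h (x /\<^sub>R norm x) * norm x"
      using False by (intro mult_right_mono u0(2)) auto
    also have "\<dots> = h x"
    proof -
      have *: "max 0 (y / norm x) * norm x = max 0 y" for y
        using False by (auto simp: max_def zero_le_divide_iff)
      show ?thesis
        by (simp add: h_def matrix_vector_mult_scaleR distrib_right sum_distrib_right *
            divide_inverse_commute[symmetric])
    qed
    finally show ?thesis .
  qed (simp add: h0)
  define S where "S = ?P \<inter> {x. \<xi> \<bullet> x \<le> \<xi> \<bullet> p}"
  define M where "M = (\<Sum>i\<in>UNIV. max 0 (\<beta> $ i)) + max 0 (\<xi> \<bullet> p)"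
  have P: "?P = (\<Inter>i. {x. A $ i \<bullet> x \<le> \<beta> $ i})"
    by (auto simp: less_eq_vec_def matrix_vector_mul_component)
  have "closed ?P" "convex ?P"
    unfolding P by (auto intro!: closed_INT closed_halfspace_le convex_INT convex_halfspace_le)
  have "norm x \<le> M / h u0" if "x \<in> S" for x
  proof -
    have "h x \<le> M"
      unfolding h_def M_def using that
      by (intro add_mono sum_mono max.mono) (auto simp: S_def less_eq_vec_def)
    then show ?thesis
      using h_ge[of x] \<open>0 < h u0\<close> by (simp add: field_simps)
  qed
  then have "bounded S"
    unfolding bounded_iff by blast
  moreover have "closed S"
    unfolding S_def using \<open>closed ?P\<close> closed_halfspace_le by blast
  ultimately have "compact S"
    by (simp add: compact_eq_bounded_closed)
  moreover have "p \<in> S"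
    using p by (simp add: S_def)
  ultimately obtain q where q: "q \<in> S" "\<And>x. x \<in> S \<Longrightarrow> \<xi> \<bullet> q \<le> \<xi> \<bullet> x"
    using continuous_attains_inf[of S "\<lambda>x. \<xi> \<bullet> x"] continuous_on_inner[OF continuous_on_const continuous_on_id]
    by blast
  have q_min: "\<xi> \<bullet> q \<le> \<xi> \<bullet> x" if "x \<in> ?P" for x
    using q that by (cases "x \<in> S") (auto simp: S_def)
  define Fc where "Fc = ?P \<inter> {x. \<xi> \<bullet> x = \<xi> \<bullet> q}"
  have "Fc face_of ?P"
    unfolding Fc_def using \<open>convex ?P\<close> q_min by (rule face_of_Int_supporting_hyperplane_ge)
  have "Fc = S \<inter> {x. \<xi> \<bullet> x = \<xi> \<bullet> q}"
    using q(1) by (auto simp: Fc_def S_def)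
  then have "compact Fc"
    using \<open>compact S\<close> by (simp add: closed_hyperplane compact_Int_closed)
  moreover have "convex Fc"
    using \<open>Fc face_of ?P\<close> by (rule face_of_imp_convex)
  moreover have "Fc \<noteq> {}"
    using q(1) by (auto simp: Fc_def S_def)
  ultimately obtain w where "w extreme_point_of Fc"
    using extreme_point_exists_convex by blast
  then have "w extreme_point_of ?P" "w \<in> Fc"
    using extreme_point_of_face[OF \<open>Fc face_of ?P\<close>] by auto
  with q_min show ?thesis
    by (intro exI[of _ w]) (auto simp: Fc_def)
qed

section \<open>Valuations and rational cones\<close>

lemma ratfun_const_0: "ratfun_const 0 = 0"
  by (simp add: ratfun_const_def Zero_fract_def)

lemma ratfun_const_1: "ratfun_const 1 = 1"
  by (simp add: ratfun_const_def One_fract_def)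

lemma ratfun_const_add: "ratfun_const (x + y) = ratfun_const x + ratfun_const y"
  by (simp add: ratfun_const_def single_add)

lemma ratfun_const_sum: "ratfun_const (\<Sum>i\<in>N. c i) = (\<Sum>i\<in>N. ratfun_const (c i))"
  by (induction N rule: infinite_finite_induct) (auto simp: ratfun_const_0 ratfun_const_add)

text \<open>The valuation property concerns sets of polyhedra; a family may repeat a polyhedron, so
  the coefficients over each fibre of \<open>Q\<close> are added first.\<close>

lemma valuation_family:
  assumes f: "valuation_on_rational_polyhedra f" and N: "finite N"
    and Q: "\<And>i. i \<in> N \<Longrightarrow> rational_polyhedron (Q i)"
    and zero: "\<And>x. (\<Sum>i\<in>N. c i * indicator (Q i) x) = (0::real)"
  shows "(\<Sum>i\<in>N. ratfun_const (complex_of_real (c i)) * f (Q i)) = 0"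
proof -
  define d where "d R = (\<Sum>i | i \<in> N \<and> Q i = R. c i)" for R
  have "(\<Sum>R\<in>Q ` N. d R * indicator R x) = (0::real)" for x
  proof -
    have "(\<Sum>R\<in>Q ` N. d R * indicator R x) = (\<Sum>R\<in>Q ` N. \<Sum>i | i \<in> N \<and> Q i = R. c i * indicator (Q i) x)"
      by (simp add: d_def sum_distrib_right)
    also have "\<dots> = (\<Sum>i\<in>N. c i * indicator (Q i) x)"
      by (rule sum.image_gen[OF N, symmetric])
    finally show ?thesis
      using zero by simp
  qed
  then have "(\<Sum>R\<in>Q ` N. ratfun_const (complex_of_real (d R)) * f R) = 0"
    using f N Q unfolding valuation_on_rational_polyhedra_def by blast
  moreover have "(\<Sum>i\<in>N. ratfun_const (complex_of_real (c i)) * f (Q i))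
    = (\<Sum>R\<in>Q ` N. \<Sum>i | i \<in> N \<and> Q i = R. ratfun_const (complex_of_real (c i)) * f (Q i))"
    by (rule sum.image_gen[OF N])
  moreover have "\<dots> = (\<Sum>R\<in>Q ` N. ratfun_const (complex_of_real (d R)) * f R)"
    by (simp add: d_def ratfun_const_sum sum_distrib_right)
  ultimately show ?thesis
    by simp
qed

lemma rational_polyhedron_cone:
  assumes "polyhedral_cone_over \<rat> Q"
  shows "rational_polyhedron Q"
proof -
  obtain H where "finite H" "H \<subseteq> vectors_over \<rat>" "Q = polar H"
    using assms unfolding polyhedral_cone_over_def by blast
  then show ?thesis
    unfolding rational_polyhedron_def
    by (intro exI[of _ "(\<lambda>a. (a, 0)) ` H"]) (auto simp: vectors_over_def polar_def)
qed

text \<open>Scaling inside the cone allows every right-hand side to be replaced by 0. This recovers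
  rational coefficients from \<open>Q\<close> itself, whatever matrix it was first defined
  by.\<close>

lemma polyhedral_cone_over_rational:
  assumes Q: "rational_polyhedron Q" and cone: "convex_cone Q"
  shows "polyhedral_cone_over \<rat> Q"
proof -
  obtain H where H: "finite H" "\<forall>(a, \<beta>)\<in>H. (\<forall>i. a $ i \<in> \<rat>) \<and> \<beta> \<in> \<rat>"
      "Q = {x. \<forall>(a, \<beta>)\<in>H. a \<bullet> x \<le> \<beta>}"
    using Q unfolding rational_polyhedron_def by blast
  have "0 \<in> Q"
    using cone by (rule convex_cone_contains_0)
  then have \<beta>: "0 \<le> \<beta>" if "(a, \<beta>) \<in> H" for a \<beta>
    using that by (auto simp: H(3))
  have "a \<bullet> x \<le> 0" if x: "x \<in> Q" and a: "(a, \<beta>) \<in> H" for x a \<beta>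
  proof (rule ccontr)
    assume neg: "\<not> a \<bullet> x \<le> 0"
    define s where "s = (\<beta> + 1) / (a \<bullet> x)"
    have "s *\<^sub>R x \<in> Q"
      using neg \<beta>[OF a] x by (intro convex_cone_scaleR[OF cone]) (auto simp: s_def)
    then have "s * (a \<bullet> x) \<le> \<beta>"
      using a by (auto simp: H(3))
    then show False
      using neg by (simp add: s_def)
  qed
  then have "Q \<subseteq> polar (fst ` H)"
    by (auto simp: polar_def)
  moreover have "polar (fst ` H) \<subseteq> Q"
    using \<beta> by (force simp: H(3) polar_def)
  moreover have "fst ` H \<subseteq> vectors_over \<rat>"
  proof
    fix a assume "a \<in> fst ` H"
    then obtain \<beta> where "(a, \<beta>) \<in> H"
      by auto
    then show "a \<in> vectors_over \<rat>"
      using H(2) unfolding vectors_over_def by blast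
  qed
  ultimately show ?thesis
    using H(1) unfolding polyhedral_cone_over_def by (intro exI[of _ "fst ` H"]) auto
qed

text \<open>Moving the cones with lines to the left gives a vanishing combination, to which the
  valuation property applies; \<open>f\<close> is 0 on the added terms.\<close>

lemma generating_function_line_combination:
  assumes f: "is_generating_function f" and N: "finite N"
    and Q: "\<And>i. i \<in> N \<Longrightarrow> rational_polyhedron (Q i)"
    and line: "line_combination \<rat> (\<lambda>x. \<Sum>i\<in>N. c i * indicator (Q i) x)"
  shows "(\<Sum>i\<in>N. ratfun_const (complex_of_real (c i)) * f (Q i)) = 0"
proof -
  obtain I d where I: "finite I" "I \<subseteq> {Q. polyhedral_cone_over \<rat> Q \<and> contains_line Q}"
      "(\<lambda>x. \<Sum>i\<in>N. c i * indicator (Q i) x) = (\<lambda>x. \<Sum>R\<in>I. d R * indicator R x)"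
    using line unfolding line_combination_def indicator_combination_def by blast
  have rat: "rational_polyhedron R" "f R = 0" if "R \<in> I" for R
    using that I(2) f rational_polyhedron_cone[of R] by (auto simp: is_generating_function_def)
  let ?c = "case_sum c (\<lambda>R. - d R)" and ?Q = "case_sum Q (\<lambda>R. R)"
  have "(\<Sum>k\<in>N <+> I. ?c k * indicator (?Q k) x) = (0::real)" for x
    using N I(1) fun_cong[OF I(3), of x] by (simp only: sum.Plus) (simp add: o_def sum_negf del: sum_mult_indicator)
  then have "(\<Sum>k\<in>N <+> I. ratfun_const (complex_of_real (?c k)) * f (?Q k)) = 0"
    using f N I(1) Q rat(1)
    by (intro valuation_family) (auto simp: is_generating_function_def)
  then show ?thesis
    using N I(1) rat(2) by (simp add: sum.Plus o_def)
qed

section \<open>Vertices of a varying polyhedron\<close>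

theorem theorem3p1:
  fixes A :: "real ^ ('n::{finite,linorder}) ^ 'm"
    and b :: "real ^ 'm"
    and bt :: "real \<Rightarrow> real ^ 'm"
    and T :: "real set"
    and l :: nat
    and w :: "real \<Rightarrow> nat \<Rightarrow> real ^ ('n::{finite,linorder})"
    and K :: "nat \<Rightarrow> (real ^ ('n::{finite,linorder})) set"
    and P :: "(real ^ ('n::{finite,linorder})) set"
    and Pt :: "real \<Rightarrow> (real ^ ('n::{finite,linorder})) set"
  assumes P_def: "P = {x. A *v x \<le> b}"
    and Pt_def: "\<And>t. Pt t = {x. A *v x \<le> bt t}"
    and P_nonempty: "P \<noteq> {}"
    and T_interval: "is_interval T" "0 \<in> T" "T \<noteq> {0}"
    and bt_continuous: "continuous_on T bt"
    and bt_0: "bt 0 = b"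
    and Pt_nonempty: "\<And>t. t \<in> T \<Longrightarrow> t \<noteq> 0 \<Longrightarrow> Pt t \<noteq> {}"
    and Pt_vertices: "\<And>t. t \<in> T \<Longrightarrow> t \<noteq> 0 \<Longrightarrow>
          bij_betw (w t) {1..l} {x. x extreme_point_of Pt t}"
    and Pt_fcone: "\<And>t j. t \<in> T \<Longrightarrow> t \<noteq> 0 \<Longrightarrow> j \<in> {1..l} \<Longrightarrow> fcone (Pt t) (w t j) = K j"
  shows "(\<forall>j\<in>{1..l}. \<exists>v. v extreme_point_of P \<and> ((\<lambda>t. w t j) \<longlongrightarrow> v) (at 0 within T))
    \<and> (\<forall>v. v extreme_point_of P \<longrightarrow>
        (let J = {j\<in>{1..l}. ((\<lambda>t. w t j) \<longlongrightarrow> v) (at 0 within T)} in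
          cong_mod_lines (indicator (fcone P v)) (\<lambda>x. \<Sum>j\<in>J. indicator (K j) x)
          \<and> (rational_polyhedron (fcone P v) \<and> (\<forall>j\<in>J. rational_polyhedron (K j)) \<longrightarrow>
              (\<forall>f. is_generating_function f \<longrightarrow> f (fcone P v) = (\<Sum>j\<in>J. f (K j))))))"
proof -
  \<comment> \<open>An interval with more than one point accumulates at each of its points, so
    limits at 0 are not vacuous.\<close>
  have "0 islimpt T"
    using T_interval by (intro connected_imp_perfect) (auto simp: is_interval_connected)
  then have nontriv: "at 0 within T \<noteq> bot"
    by (simp add: trivial_limit_within)
  \<comment> \<open>As \<open>K j\<close> does not depend on \<open>t\<close>, its properties can be
    read off at one parameter \<open>t0\<close>.\<close>
  then obtain t0 where t0: "t0 \<in> T" "t0 \<noteq> 0"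
    using T_interval(2,3) by blast
  have bt_lim: "(bt \<longlongrightarrow> b) (at 0 within T)"
    using bt_continuous T_interval(2) bt_0 by (auto simp: continuous_on_def)
  have w_extreme: "w t j extreme_point_of Pt t" if "t \<in> T" "t \<noteq> 0" "j \<in> {1..l}" for t j
    using bij_betwE[OF Pt_vertices[OF that(1,2)]] that(3) by blast
  have w_in: "A *v w t j \<le> bt t" if "t \<in> T" "t \<noteq> 0" "j \<in> {1..l}" for t j
    using w_extreme[OF that] by (simp add: extreme_point_of_def Pt_def)
  have K_cone: "polyhedral_cone_over UNIV (K j)" if "j \<in> {1..l}" for j
    using polyhedral_cone_over_fcone[OF w_in[OF t0 that]] Pt_fcone[OF t0 that] by (simp add: Pt_def)
  then have K_convex_cone: "convex_cone (K j)" if "j \<in> {1..l}" for j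
    using that convex_cone_polar unfolding polyhedral_cone_over_def by metis
  have K_pointed: "u = 0" if "j \<in> {1..l}" "u \<in> K j" "- u \<in> K j" for j u
    using fcone_extreme_point_pointed[OF w_extreme[OF t0 that(1)]] that by (simp add: Pt_fcone[OF t0])
  have Pt_diff: "x - w t j \<in> K j" if "t \<in> T" "t \<noteq> 0" "j \<in> {1..l}" "x \<in> Pt t" for t j x
    using diff_in_fcone[OF w_in[OF that(1-3)], of x] that by (simp add: Pt_def flip: Pt_fcone[OF that(1-3)])

  \<comment> \<open>Limits of the moving vertices\<close>
  have limit: "v \<in> P" "\<And>x. x \<in> P \<Longrightarrow> x - v \<in> K j" "v extreme_point_of P"
    if j: "j \<in> {1..l}" and lim: "((\<lambda>t. w t j) \<longlongrightarrow> v) (at 0 within T)" for j v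
  proof -
    have ev: "\<forall>\<^sub>F t in at 0 within T. A *v w t j \<le> bt t \<and> fcone {x. A *v x \<le> bt t} (w t j) = K j"
      unfolding eventually_at_filter using w_in Pt_fcone j by (auto simp: Pt_def)
    show v: "v \<in> P" "\<And>x. x \<in> P \<Longrightarrow> x - v \<in> K j"
      using diff_limit_in_fcone[OF nontriv bt_lim lim ev] by (auto simp: P_def)
    then show "v extreme_point_of P"
      using K_convex_cone K_pointed j by (intro extreme_point_ofI_pointed_cone[of _ _ "K j"])
  qed
  have converges: "\<exists>v. v extreme_point_of P \<and> ((\<lambda>t. w t j) \<longlongrightarrow> v) (at 0 within T)" if "j \<in> {1..l}" for j
    using vertex_convergent[OF nontriv bt_lim, of A "\<lambda>t. w t j" "K j"] w_in Pt_fcone K_pointed limit(3) that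
    unfolding Pt_def by metis

  \<comment> \<open>The identity at a fixed vertex\<close>
  have "cong_mod_lines (indicator (fcone P v)) (\<lambda>x. \<Sum>j\<in>J. indicator (K j) x)
      \<and> (rational_polyhedron (fcone P v) \<and> (\<forall>j\<in>J. rational_polyhedron (K j)) \<longrightarrow>
          (\<forall>f. is_generating_function f \<longrightarrow> f (fcone P v) = (\<Sum>j\<in>J. f (K j))))"
    if v: "v extreme_point_of P" and J: "J = {j\<in>{1..l}. ((\<lambda>t. w t j) \<longlongrightarrow> v) (at 0 within T)}" for v J
  proof -
    have "v \<in> P"
      using v by (simp add: extreme_point_of_def)
    then have Av: "A *v v \<le> b"
      by (simp add: P_def)
    have finJ: "finite J" and J0: "0 \<notin> J" and Jl: "\<And>j. j \<in> J \<Longrightarrow> j \<in> {1..l}"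
      and Jlim: "\<And>j. j \<in> J \<Longrightarrow> ((\<lambda>t. w t j) \<longlongrightarrow> v) (at 0 within T)"
      by (auto simp: J)
    have P_diff: "x - v \<in> fcone P v" if "x \<in> P" for x
      using diff_in_fcone[OF Av, of x] that by (simp add: P_def)
    have cone_v: "polyhedral_cone_over UNIV (fcone P v)"
      using polyhedral_cone_over_fcone[OF Av] by (simp add: P_def)
    \<comment> \<open>Vertices are numbered from 1, so index 0 is free for the feasible cone of
      \<open>P\<close>. With coefficient 1 there and -1 elsewhere, the congruence says that one sum
      vanishes modulo lines.\<close>
    define C where "C = K(0 := fcone P v)"
    define c where "c j = (if j = 0 then 1 else - 1 :: real)" for j :: nat
    have C: "C 0 = fcone P v" "\<And>j. j \<in> J \<Longrightarrow> C j = K j" "\<And>j. j \<in> J \<Longrightarrow> c j = - 1" "c 0 = 1"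
      using J0 by (auto simp: C_def c_def intro: gr0I)
    \<comment> \<open>A feasible direction is a positive multiple of some \<open>x - v\<close> with
      \<open>x \<in> P\<close>, and these differences lie in \<open>K j\<close>.\<close>
    have fcone_subset: "fcone P v \<subseteq> K j" if "j \<in> J" for j
    proof
      fix u assume "u \<in> fcone P v"
      then obtain \<delta> where \<delta>: "0 < \<delta>" "v + \<delta> *\<^sub>R u \<in> P"
        by (rule fcone_step)
      have "\<delta> *\<^sub>R u \<in> K j"
        using limit(2)[OF Jl[OF that] Jlim[OF that] \<delta>(2)] by simp
      then have "(1 / \<delta>) *\<^sub>R (\<delta> *\<^sub>R u) \<in> K j"
        using \<delta>(1) by (intro convex_cone_scaleR[OF K_convex_cone[OF Jl[OF that]], of "1 / \<delta>"]) auto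
      then show "u \<in> K j"
        using \<delta>(1) by simp
    qed
    \<comment> \<open>A functional positive on both cones would have two distinct vertices of
      \<open>Pt t0\<close> as strict minimizers.\<close>
    have unique: "j = j'" if "j \<in> {1..l}" "j' \<in> {1..l}" "positive_on \<xi> (K j)" "positive_on \<xi> (K j')" for j j' \<xi>
    proof (rule ccontr)
      assume "j \<noteq> j'"
      then have "w t0 j \<noteq> w t0 j'"
        using bij_betw_imp_inj_on[OF Pt_vertices[OF t0]] that(1,2) by (auto dest: inj_onD)
      moreover have "w t0 j' - w t0 j \<in> K j" "w t0 j - w t0 j' \<in> K j'"
        using that(1,2) w_in[OF t0] by (auto intro!: Pt_diff t0 simp: Pt_def)
      ultimately have "0 < \<xi> \<bullet> (w t0 j' - w t0 j)" "0 < \<xi> \<bullet> (w t0 j - w t0 j')"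
        using that(3,4) by (auto simp: positive_on_def)
      then show False
        by (simp add: inner_diff_right)
    qed
    have count: "(\<Sum>i | i \<in> insert 0 J \<and> positive_on \<xi> (C i). c i) = 0"
      if generic: "\<And>i. i \<in> insert 0 J \<Longrightarrow> (\<And>x. x \<in> C i \<Longrightarrow> 0 \<le> \<xi> \<bullet> x) \<Longrightarrow> positive_on \<xi> (C i)" for \<xi>
    proof (cases "positive_on \<xi> (fcone P v)")
      case False
      then have "\<not> positive_on \<xi> (K j)" if "j \<in> J" for j
        using fcone_subset[OF that] by (auto simp: positive_on_def)
      with False have "\<not> positive_on \<xi> (C i)" if "i \<in> insert 0 J" for i
        using that C by (elim insertE) simp_all
      then have "{i. i \<in> insert 0 J \<and> positive_on \<xi> (C i)} = {}"
        by blast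
      then show ?thesis
        by (simp only: sum.empty)
    next
      case True
      \<comment> \<open>The recession directions depend on \<open>A\<close> only and are feasible at
        \<open>v\<close>; hence \<xi> attains its minimum over \<open>Pt t0\<close> at a
        vertex.\<close>
      have pos: "0 < \<xi> \<bullet> u" if "A *v u \<le> 0" "u \<noteq> 0" for u
      proof -
        have "u \<in> fcone P v"
          unfolding P_def fcone_polyhedron[OF Av] using that(1) by (auto simp: less_eq_vec_def)
        then show ?thesis
          using True that(2) by (auto simp: positive_on_def)
      qed
      obtain x where x: "x extreme_point_of Pt t0" "\<And>y. y \<in> Pt t0 \<Longrightarrow> \<xi> \<bullet> x \<le> \<xi> \<bullet> y"
        using exists_minimizing_vertex[OF Pt_nonempty[OF t0, unfolded Pt_def] pos] by (auto simp: Pt_def)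
      then obtain j where j: "j \<in> {1..l}" "x = w t0 j"
        using bij_betw_imp_surj_on[OF Pt_vertices[OF t0]] by blast
      \<comment> \<open>Minimality yields only nonnegativity on \<open>K j\<close>; genericity makes
        it strict once \<open>j \<in> J\<close> is known.\<close>
      have nonneg: "0 \<le> \<xi> \<bullet> u" if "u \<in> K j" for u
      proof -
        have "u \<in> fcone (Pt t0) (w t0 j)"
          using that Pt_fcone[OF t0 j(1)] by simp
        then obtain \<delta> where \<delta>: "0 < \<delta>" "w t0 j + \<delta> *\<^sub>R u \<in> Pt t0"
          by (rule fcone_step)
        then show ?thesis
          using x(2)[OF \<delta>(2)] j(2) by (simp add: inner_right_distrib zero_le_mult_iff)
      qed
      obtain v' where v': "((\<lambda>t. w t j) \<longlongrightarrow> v') (at 0 within T)"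
        using converges[OF j(1)] by blast
      \<comment> \<open>Otherwise positivity on the feasible cone at \<open>v\<close> gives
        \<open>\<xi> \<bullet> v < \<xi> \<bullet> v'\<close>, while nonnegativity on
        \<open>K j\<close> gives the reverse inequality.\<close>
      have "v' = v"
      proof (rule ccontr)
        assume "v' \<noteq> v"
        have "0 < \<xi> \<bullet> (v' - v)"
          using True P_diff[OF limit(1)[OF j(1) v']] \<open>v' \<noteq> v\<close> by (auto simp: positive_on_def)
        moreover have "0 \<le> \<xi> \<bullet> (v - v')"
          using limit(2)[OF j(1) v' \<open>v \<in> P\<close>] by (rule nonneg)
        ultimately show False
          by (simp add: inner_diff_right)
      qed
      then have "j \<in> J"
        using j(1) v' by (simp add: J)
      then have "positive_on \<xi> (K j)"
        using generic[of j] nonneg C(2) by simp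
      have "{i. i \<in> insert 0 J \<and> positive_on \<xi> (C i)} = {0, j}"
      proof (intro equalityI subsetI)
        fix i assume "i \<in> {i. i \<in> insert 0 J \<and> positive_on \<xi> (C i)}"
        then show "i \<in> {0, j}"
          using unique[OF _ j(1) _ \<open>positive_on \<xi> (K j)\<close>] Jl C(2) by auto
      qed (use True \<open>positive_on \<xi> (K j)\<close> \<open>j \<in> J\<close> C in auto)
      then show ?thesis
        using \<open>j \<in> J\<close> J0 C by (cases "j = 0") simp_all
    qed
    \<comment> \<open>The count is independent of \<open>F\<close>, so one argument serves real and
      rational coefficients.\<close>
    have key: "line_combination F (\<lambda>x. \<Sum>i\<in>insert 0 J. c i * indicator (C i) x)"
      if "subring F" "\<And>i. i \<in> insert 0 J \<Longrightarrow> polyhedral_cone_over F (C i)" for F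
      using that finJ count by (intro line_combination_cones) auto
    have "(\<Sum>i\<in>insert 0 J. c i * indicator (C i) x) = indicator (fcone P v) x - (\<Sum>j\<in>J. indicator (K j) x)" for x
    proof -
      have "(\<Sum>j\<in>J. c j * indicator (C j) x) = (\<Sum>j\<in>J. - indicator (K j) x)"
        by (rule sum.cong) (simp_all add: C)
      then show ?thesis
        using finJ J0 C by (simp add: sum_negf del: sum_mult_indicator)
    qed
    moreover have over: "polyhedral_cone_over UNIV (C i)" if "i \<in> insert 0 J" for i
      using that cone_v K_cone Jl C by auto
    ultimately have "line_combination UNIV (\<lambda>x. indicator (fcone P v) x - (\<Sum>j\<in>J. indicator (K j) x))"
      using key[OF subring_UNIV] by simp
    moreover have "polyhedron (fcone P v)" "\<And>j. j \<in> J \<Longrightarrow> polyhedron (K j)"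
      using cone_v K_cone[OF Jl] polyhedron_polar unfolding polyhedral_cone_over_def by metis+
    ultimately have cong: "cong_mod_lines (indicator (fcone P v)) (\<lambda>x. \<Sum>j\<in>J. indicator (K j) x)"
      unfolding cong_mod_lines_def
      by (auto intro: line_combination_polyhedra indicator_combination_indicator
          intro!: indicator_combination_sum)

    \<comment> \<open>Passage to generating functions\<close>
    have "f (fcone P v) = (\<Sum>j\<in>J. f (K j))"
      if f: "is_generating_function f" and rat: "rational_polyhedron (fcone P v)" "\<forall>j\<in>J. rational_polyhedron (K j)" for f
    proof -
      have ratC: "rational_polyhedron (C i)" if "i \<in> insert 0 J" for i
        using that rat C by auto
      have "convex_cone (C i)" if "i \<in> insert 0 J" for i
        using over[OF that] convex_cone_polar unfolding polyhedral_cone_over_def by metis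
      then have "line_combination \<rat> (\<lambda>x. \<Sum>i\<in>insert 0 J. c i * indicator (C i) x)"
        using ratC by (intro key subring_Rats polyhedral_cone_over_rational)
      then have "(\<Sum>i\<in>insert 0 J. ratfun_const (complex_of_real (c i)) * f (C i)) = 0"
        using finJ ratC by (intro generating_function_line_combination[OF f]) auto
      moreover have "ratfun_const (- 1) = (- 1 :: 'n ratfun)"
        using ratfun_const_add[of "- 1" 1, where ?'a = 'n] by (simp add: ratfun_const_0 ratfun_const_1 eq_neg_iff_add_eq_0)
      moreover have "(\<Sum>j\<in>J. ratfun_const (complex_of_real (c j)) * f (C j)) = (\<Sum>j\<in>J. ratfun_const (- 1) * f (K j))"
        by (rule sum.cong) (simp_all add: C)
      ultimately show ?thesis
        using finJ J0 C by (simp add: ratfun_const_1 sum_negf)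
    qed
    with cong show ?thesis
      by blast
  qed
  with converges show ?thesis
    by (simp add: Let_def)
qed

end
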